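(* Let $\mathsf{k}$ be a field of characteristic $2$, let $G=\langle g\rangle\cong\mathbb{Z}/n\mathbb{Z}$ be the cyclic group of order $n$ with $n$ divisible by $2$, and let $V$ be the two-dimensional right $\mathsf{k}G$-module with basis $\{v_1,v_2\}$ and action $v_1\cdot g=v_1$, $v_2\cdot g=v_1+v_2$, regarded as a Yetter--Drinfeld module over $\mathsf{k}G$ concentrated in degree $g$ (that is, $V_g=V$). Write $a=v_1$ and $b=v_2$. Then the Nichols algebra $\mathcal{B}(V)$ is the quotient of the tensor algebra $T(V)=\mathsf{k}\langle a,b\rangle$ by the two-sided ideal generated by $$a^2,\qquad b^4,\qquad b^2a+ab^2+aba,\qquad abab+baba.$$ It has dimension $16$ and basis (images of) $$1,\ a,\ b,\ ab,\ ba,\ b^2,\ aba,\ ab^2,\ bab,\ b^3,\ abab,\ ab^3,\ bab^2,\ abab^2,\ bab^3,\ abab^3.$$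
   Context: Definition of the Nichols algebra used here. Let $Q$ be the quiver with vertex set $G$ and, for each $0\le j\le n-1$, exactly two arrows from $g^j$ to $g^{j+1}$, denoted $a^{i}_{g^j}$ ($i=1,2$), where $a^i_{g^j}$ corresponds to $g^j\otimes v_i$ in $B=\mathsf{k}G\otimes V$. For an arrow $\alpha$, $s(\alpha)$ and $t(\alpha)$ denote its source and target. For $v=\lambda_1v_1+\lambda_2v_2\in V$ identify $h\otimes v$ with $\lambda_1a^1_h+\lambda_2a^2_h$. The group $G$ acts on the span $B$ of the arrows on the left by $l\cdot(h\otimes v)=lh\otimes v$ and on the right by $(h\otimes v)\cdot l=hl\otimes (v\cdot l)$. Let $\mathsf{k}Q$ be the path coalgebra: the vector space with basis all paths $a_m\cdots a_2a_1$ (arrows with $s(a_{j+1})=t(a_j)$; vertices are paths of length $0$), with $\Delta(h)=h\otimes h$ for $h\in G$ and $\Delta(a_m\cdots a_1)=\sum_{i=0}^m a_m\cdots a_{i+1}\otimes a_i\cdots a_1$, where the empty products for $i=m$ and $i=0$ are read as $t(a_m)$ and $s(a_1)$ respectively. $\mathsf{k}Q$ is a pointed graded Hopf algebra with the following product. For a path $\alpha$ of length $m$ and a subset $d\subseteq\{1,\dots,q\}$ of cardinality $m$, let $d\alpha=((d\alpha)_q,\dots,(d\alpha)_1)$ be the unique sequence of vertices and arrows whose concatenation is $\alpha$ and whose arrows occupy exactly the positions in $d$. For paths $\alpha,\beta$ of lengths $m,m'$, $$\alpha\cdot\beta=\sum_{d}\big[(d\alpha)_{m+m'}\cdot(\overline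 d\beta)_{m+m'}\big]\cdots\big[(d\alpha)_1\cdot(\overline d\beta)_1\big],$$ the sum being over all $m$-element subsets $d$ of $\{1,\dots,m+m'\}$, where $\overline d$ is the complement of $d$, each factor $(d\alpha)_i\cdot(\overline d\beta)_i$ is given by the left or right action of $G$ on $B$ (exactly one of the two entries is an arrow, the other a vertex), and the square brackets are concatenated as paths (extended multilinearly). For two vertices the product is the product in $G$. The Nichols algebra $\mathcal{B}(V)$ is the subalgebra of $\mathsf{k}Q$ generated by $V$, identified with the span of the arrows $1\otimes v_1$ and $1\otimes v_2$ from $1$ to $g$. (This agrees with the usual Nichols algebra of the Yetter--Drinfeld module $V$.) The isomorphism in the claim is the one induced by the algebra map $T(V)\to\mathcal{B}(V)$ extending the inclusion of $V$, so $a\mapsto 1\otimes v_1$, $b\mapsto 1\otimes v_2$. *)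

theory Defs
  imports
    Complex_Main
    "HOL-Library.Poly_Mapping"
    "HOL-Algebra.QuotRing"
    "HOL-Algebra.Generated_Groups"
begin

text \<open>The free vector space over \<open>'k\<close> on the basis \<open>'x\<close> is \<open>'x \<Rightarrow>\<^sub>0 'k\<close>, with the following scalar
  multiplication.\<close>

definition scale :: "'k::field \<Rightarrow> ('x \<Rightarrow>\<^sub>0 'k) \<Rightarrow> ('x \<Rightarrow>\<^sub>0 'k)" where
  "scale c x = Poly_Mapping.map ((*) c) x"

lemma lookup_scale: "Poly_Mapping.lookup (scale c x) k = c * Poly_Mapping.lookup x k"
  by (simp add: scale_def Poly_Mapping.map.rep_eq when_def)

global_interpretation vs: vector_space scale
  by unfold_locales (auto intro!: poly_mapping_eqI simp: lookup_scale lookup_add algebra_simps)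


datatype vbasis = V1 | V2

text \<open>\<open>V\<close> is \<open>vbasis \<Rightarrow>\<^sub>0 'k\<close>, with the basis vectors \<open>v\<^sub>1, v\<^sub>2\<close>.\<close>

abbreviation basis_vec :: "vbasis \<Rightarrow> (vbasis \<Rightarrow>\<^sub>0 'k::field)" where
  "basis_vec i \<equiv> Poly_Mapping.single i 1"

definition right_module :: "('g, 'm) monoid_scheme \<Rightarrow> (('x \<Rightarrow>\<^sub>0 'k::field) \<Rightarrow> 'g \<Rightarrow> ('x \<Rightarrow>\<^sub>0 'k)) \<Rightarrow> bool"
  where "right_module G act \<longleftrightarrow>
    (\<forall>h\<in>carrier G. Vector_Spaces.linear scale scale (\<lambda>v. act v h)) \<and>
    (\<forall>v. act v \<one>\<^bsub>G\<^esub> = v) \<and>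
    (\<forall>v. \<forall>h\<in>carrier G. \<forall>l\<in>carrier G. act v (h \<otimes>\<^bsub>G\<^esub> l) = act (act v h) l)"


text \<open>Words in the letters \<open>V1, V2\<close> under concatenation form the free monoid, written additively, so
  that \<open>word \<Rightarrow>\<^sub>0 'k\<close> with the convolution product of \<^theory>\<open>HOL-Library.Poly_Mapping\<close> is the
  tensor algebra \<open>T(V)\<close>.\<close>

datatype word = Word "vbasis list"

instantiation word :: monoid_add
begin

definition zero_word :: word where
  "zero_word = Word []"

fun plus_word :: "word \<Rightarrow> word \<Rightarrow> word" where
  "plus_word (Word u) (Word v) = Word (u @ v)"

instance
proof
  fix u v w :: word
  show "u + v + w = u + (v + w)"
    by (cases u; cases v; cases w) simp
  show "0 + u = u" "u + 0 = u"
    by (cases u; simp add: zero_word_def)+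
qed

end

definition tensor_algebra :: "(word \<Rightarrow>\<^sub>0 'k::field) ring" where
  "tensor_algebra = \<lparr>carrier = UNIV, mult = (*), one = 1, zero = 0, add = (+)\<rparr>"

definition tensor_gen :: "vbasis \<Rightarrow> (word \<Rightarrow>\<^sub>0 'k::field)" where
  "tensor_gen i = Poly_Mapping.single (Word [i]) 1"


text \<open>\<open>Arrow h V1\<close> and \<open>Arrow h V2\<close> are the two arrows from \<open>h\<close> to \<open>hg\<close>; \<open>Arrow h i\<close> corresponds to
  \<open>h \<otimes> v\<^sub>i\<close>, and \<open>B\<close> is \<open>'g arrow \<Rightarrow>\<^sub>0 'k\<close>.\<close>

datatype 'g arrow = Arrow (arrow_source: 'g) (arrow_label: vbasis)

definition arrow_target :: "('g, 'm) monoid_scheme \<Rightarrow> 'g \<Rightarrow> 'g arrow \<Rightarrow> 'g" where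
  "arrow_target G g a = arrow_source a \<otimes>\<^bsub>G\<^esub> g"

definition tensor :: "'g \<Rightarrow> (vbasis \<Rightarrow>\<^sub>0 'k::field) \<Rightarrow> ('g arrow \<Rightarrow>\<^sub>0 'k)" where
  "tensor h v =
     Poly_Mapping.single (Arrow h V1) (Poly_Mapping.lookup v V1) +
     Poly_Mapping.single (Arrow h V2) (Poly_Mapping.lookup v V2)"

text \<open>The actions of \<open>G\<close> on \<open>B\<close>, on the basis of arrows.\<close>

definition arrow_lact :: "('g, 'm) monoid_scheme \<Rightarrow> 'g \<Rightarrow> 'g arrow \<Rightarrow> ('g arrow \<Rightarrow>\<^sub>0 'k::field)" where
  "arrow_lact G l a = tensor (l \<otimes>\<^bsub>G\<^esub> arrow_source a) (basis_vec (arrow_label a))"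

definition arrow_ract ::
  "('g, 'm) monoid_scheme \<Rightarrow> ((vbasis \<Rightarrow>\<^sub>0 'k::field) \<Rightarrow> 'g \<Rightarrow> (vbasis \<Rightarrow>\<^sub>0 'k)) \<Rightarrow> 'g arrow \<Rightarrow> 'g
    \<Rightarrow> ('g arrow \<Rightarrow>\<^sub>0 'k)" where
  "arrow_ract G act a l = tensor (arrow_source a \<otimes>\<^bsub>G\<^esub> l) (act (basis_vec (arrow_label a)) l)"


text \<open>A path \<open>a\<^sub>m \<cdots> a\<^sub>1\<close> is represented by its source together with the list of its arrows in the order
  in which they are traversed, \<open>[a\<^sub>1, \<dots>, a\<^sub>m]\<close>; the vertex \<open>h\<close> is \<open>(h, [])\<close>.\<close>

type_synonym 'g path = "'g \<times> 'g arrow list"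

fun path_vertex :: "('g, 'm) monoid_scheme \<Rightarrow> 'g \<Rightarrow> 'g path \<Rightarrow> nat \<Rightarrow> 'g" where
  "path_vertex G g (h, as) 0 = h"
| "path_vertex G g (h, as) (Suc r) = arrow_target G g (as ! r)"

definition path_length :: "'g path \<Rightarrow> nat" where
  "path_length p = length (snd p)"

definition path_target :: "('g, 'm) monoid_scheme \<Rightarrow> 'g \<Rightarrow> 'g path \<Rightarrow> 'g" where
  "path_target G g p = path_vertex G g p (path_length p)"

definition paths :: "('g, 'm) monoid_scheme \<Rightarrow> 'g \<Rightarrow> 'g path set" where
  "paths G g = {p. fst p \<in> carrier G \<and>
     (\<forall>r < path_length p. arrow_source (snd p ! r) \<in> carrier G \<and>
        arrow_source (snd p ! r) = path_vertex G g p r)}"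


text \<open>\<open>thin_entry G g p d i\<close> is the entry \<open>(dp)\<^sub>i\<close> of the thin split of the path \<open>p\<close> along \<open>d\<close>: the
  positions are counted from \<open>1\<close>, and the entries in the positions before \<open>i\<close> have used up the
  first \<open>r\<close> arrows of \<open>p\<close>.\<close>

datatype 'g entry = Vertex_Entry 'g | Arrow_Entry "'g arrow"

definition thin_entry :: "('g, 'm) monoid_scheme \<Rightarrow> 'g \<Rightarrow> 'g path \<Rightarrow> nat set \<Rightarrow> nat \<Rightarrow> 'g entry" where
  "thin_entry G g p d i =
     (let r = card {j \<in> d. j < i} in
      if i \<in> d then Arrow_Entry (snd p ! r) else Vertex_Entry (path_vertex G g p r))"

text \<open>The first and last clauses below are never used by thin splits along complementary sets.\<close>

fun entry_mult ::
  "('g, 'm) monoid_scheme \<Rightarrow> ((vbasis \<Rightarrow>\<^sub>0 'k::field) \<Rightarrow> 'g \<Rightarrow> (vbasis \<Rightarrow>\<^sub>0 'k)) \<Rightarrow> 'g entry \<Rightarrow> 'g entry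
    \<Rightarrow> ('g arrow \<Rightarrow>\<^sub>0 'k)" where
  "entry_mult G act (Vertex_Entry h) (Vertex_Entry l) = 0"
| "entry_mult G act (Vertex_Entry h) (Arrow_Entry a) = arrow_lact G h a"
| "entry_mult G act (Arrow_Entry a) (Vertex_Entry l) = arrow_ract G act a l"
| "entry_mult G act (Arrow_Entry a) (Arrow_Entry b) = 0"

text \<open>Concatenation \<open>[y][x]\<close>, extended bilinearly, of an element \<open>y\<close> of \<open>B\<close> after a combination \<open>x\<close>
  of paths; arrows that do not compose give \<open>0\<close>.\<close>

definition concat_arrow ::
  "('g, 'm) monoid_scheme \<Rightarrow> 'g \<Rightarrow> ('g path \<Rightarrow>\<^sub>0 'k::field) \<Rightarrow> ('g arrow \<Rightarrow>\<^sub>0 'k) \<Rightarrow> ('g path \<Rightarrow>\<^sub>0 'k)" where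
  "concat_arrow G g x y =
     (\<Sum>p\<in>Poly_Mapping.keys x. \<Sum>a\<in>Poly_Mapping.keys y.
        if path_target G g p = arrow_source a
        then Poly_Mapping.single (fst p, snd p @ [a])
               (Poly_Mapping.lookup x p * Poly_Mapping.lookup y a)
        else 0)"

text \<open>Every concatenation in the product of \<open>p\<close> and \<open>q\<close> starts at the product of their sources. For
  two vertices this is all that is left, which gives the product of \<open>G\<close>.\<close>

definition path_mult ::
  "('g, 'm) monoid_scheme \<Rightarrow> 'g \<Rightarrow> ((vbasis \<Rightarrow>\<^sub>0 'k::field) \<Rightarrow> 'g \<Rightarrow> (vbasis \<Rightarrow>\<^sub>0 'k)) \<Rightarrow> 'g path \<Rightarrow> 'g path
    \<Rightarrow> ('g path \<Rightarrow>\<^sub>0 'k)" where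
  "path_mult G g act p q =
     (let N = path_length p + path_length q in
      \<Sum>d \<in> {d. d \<subseteq> {1..N} \<and> card d = path_length p}.
        foldl (concat_arrow G g) (Poly_Mapping.single (fst p \<otimes>\<^bsub>G\<^esub> fst q, []) 1)
          (map (\<lambda>i. entry_mult G act (thin_entry G g p d i) (thin_entry G g q ({1..N} - d) i))
            [1..<Suc N]))"

definition path_algebra ::
  "('g, 'm) monoid_scheme \<Rightarrow> 'g \<Rightarrow> ((vbasis \<Rightarrow>\<^sub>0 'k::field) \<Rightarrow> 'g \<Rightarrow> (vbasis \<Rightarrow>\<^sub>0 'k))
    \<Rightarrow> ('g path \<Rightarrow>\<^sub>0 'k) ring" where
  "path_algebra G g act =
     \<lparr>carrier = {x. Poly_Mapping.keys x \<subseteq> paths G g},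
      mult = (\<lambda>x y. \<Sum>p\<in>Poly_Mapping.keys x. \<Sum>q\<in>Poly_Mapping.keys y.
        scale (Poly_Mapping.lookup x p * Poly_Mapping.lookup y q) (path_mult G g act p q)),
      one = Poly_Mapping.single (\<one>\<^bsub>G\<^esub>, []) 1,
      zero = 0,
      add = (+)\<rparr>"


definition is_subalgebra :: "('x \<Rightarrow>\<^sub>0 'k::field) set \<Rightarrow> ('x \<Rightarrow>\<^sub>0 'k) ring \<Rightarrow> bool" where
  "is_subalgebra S R \<longleftrightarrow> S \<subseteq> carrier R \<and> vs.subspace S \<and> \<one>\<^bsub>R\<^esub> \<in> S \<and> (\<forall>x\<in>S. \<forall>y\<in>S. x \<otimes>\<^bsub>R\<^esub> y \<in> S)"

definition generated_subalgebra :: "('x \<Rightarrow>\<^sub>0 'k::field) ring \<Rightarrow> ('x \<Rightarrow>\<^sub>0 'k) set \<Rightarrow> ('x \<Rightarrow>\<^sub>0 'k) set" where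
  "generated_subalgebra R X = \<Inter>{S. is_subalgebra S R \<and> X \<subseteq> S}"

text \<open>The arrow \<open>1 \<otimes> v\<^sub>i\<close> as a path of length \<open>1\<close>.\<close>

definition nichols_gen :: "('g, 'm) monoid_scheme \<Rightarrow> vbasis \<Rightarrow> ('g path \<Rightarrow>\<^sub>0 'k::field)" where
  "nichols_gen G i = Poly_Mapping.single (\<one>\<^bsub>G\<^esub>, [Arrow \<one>\<^bsub>G\<^esub> i]) 1"

definition nichols_algebra ::
  "('g, 'm) monoid_scheme \<Rightarrow> 'g \<Rightarrow> ((vbasis \<Rightarrow>\<^sub>0 'k::field) \<Rightarrow> 'g \<Rightarrow> (vbasis \<Rightarrow>\<^sub>0 'k))
    \<Rightarrow> ('g path \<Rightarrow>\<^sub>0 'k) ring" where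
  "nichols_algebra G g act =
     (path_algebra G g act)
       \<lparr>carrier := generated_subalgebra (path_algebra G g act)
                     (vs.span {nichols_gen G V1, nichols_gen G V2})\<rparr>"

end

theory Submission
  imports Defs
begin

text \<open>
  Paths starting at \<open>1\<close> are words in \<open>v\<^sub>1, v\<^sub>2\<close>, and on them the product of the path algebra is a
  twisted shuffle: a letter \<open>v\<close> of the left factor that is placed after \<open>s\<close> letters of the right
  factor becomes \<open>v \<cdot> g\<^sup>s\<close>, where \<open>v\<^sub>2 \<cdot> g\<^sup>s = v\<^sub>2 + s v\<^sub>1\<close>. Deleting the last letter of a word
  therefore acts by skew derivations with the degree operator as twist, which determines the product
  on coefficient functions recursively and makes associativity an induction on words. In
  characteristic two the coefficients of all monomials in the generators lie in \<open>{0, 1}\<close> and are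
  computed by a Boolean recursion: the four relations hold, and the sixteen monomials form a
  triangular system, hence are independent. Conversely the relations rewrite any word into the span
  of the sixteen monomials, because that span is closed under left multiplication by \<open>a\<close> and \<open>b\<close>
  modulo the relations. So the kernel of the map from the tensor algebra is exactly the ideal.
\<close>

section \<open>Free vector spaces and the product of paths\<close>

lemma scale_one_right: "scale c (Poly_Mapping.single p 1) = Poly_Mapping.single p c"
  by (rule poly_mapping_eqI) (simp add: lookup_scale lookup_single when_def)

lemma lookup_sum: "Poly_Mapping.lookup (sum f A) k = (\<Sum>i\<in>A. Poly_Mapping.lookup (f i) k)"
  by (induction A rule: infinite_finite_induct) (auto simp: lookup_add)

definition lin_ext :: "('x \<Rightarrow> ('y \<Rightarrow>\<^sub>0 'k::field)) \<Rightarrow> ('x \<Rightarrow>\<^sub>0 'k) \<Rightarrow> ('y \<Rightarrow>\<^sub>0 'k)" where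
  "lin_ext f x = (\<Sum>p\<in>Poly_Mapping.keys x. scale (Poly_Mapping.lookup x p) (f p))"

lemma lin_ext_superset:
  assumes "finite A" "Poly_Mapping.keys x \<subseteq> A"
  shows "lin_ext f x = (\<Sum>p\<in>A. scale (Poly_Mapping.lookup x p) (f p))"
  unfolding lin_ext_def
  by (rule sum.mono_neutral_left) (use assms in \<open>auto simp: in_keys_iff\<close>)

lemma linear_scaleI:
  assumes "\<And>x y. f (x + y) = f x + f y" "\<And>c x. f (scale c x) = scale c (f x)"
  shows "Vector_Spaces.linear scale scale f"
  using assms by unfold_locales auto

lemma linear_lin_ext:
  fixes f :: "'a \<Rightarrow> 'b \<Rightarrow>\<^sub>0 'c::field"
  shows "Vector_Spaces.linear scale scale (lin_ext f)"
proof (rule linear_scaleI)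
  fix x y :: "'a \<Rightarrow>\<^sub>0 'c"
  let ?A = "Poly_Mapping.keys x \<union> Poly_Mapping.keys y"
  have "Poly_Mapping.keys (x + y) \<subseteq> ?A"
    by (rule keys_add)
  then show "lin_ext f (x + y) = lin_ext f x + lin_ext f y"
    by (simp add: lin_ext_superset[of ?A] lookup_add vs.scale_left_distrib sum.distrib)
next
  fix c and x :: "'a \<Rightarrow>\<^sub>0 'c"
  have "Poly_Mapping.keys (scale c x) \<subseteq> Poly_Mapping.keys x"
    by (auto simp: in_keys_iff lookup_scale)
  then show "lin_ext f (scale c x) = scale c (lin_ext f x)"
    by (simp add: lin_ext_superset[of "Poly_Mapping.keys x"] lookup_scale vs.scale_sum_right)
qed

lemmas lin_ext_simps [simp] =
  module_hom.add[OF linear_lin_ext[unfolded Vector_Spaces.linear_iff_module_hom]]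
  module_hom.scale[OF linear_lin_ext[unfolded Vector_Spaces.linear_iff_module_hom]]
  module_hom.zero[OF linear_lin_ext[unfolded Vector_Spaces.linear_iff_module_hom]]

lemma lin_ext_single [simp]: "lin_ext f (Poly_Mapping.single p c) = scale c (f p)"
  by (simp add: lin_ext_superset[of "{p}"])

lemma lin_ext_basis: "lin_ext (\<lambda>p. Poly_Mapping.single p 1) x = x"
proof (rule poly_mapping_eqI)
  fix k
  have "Poly_Mapping.lookup (lin_ext (\<lambda>p. Poly_Mapping.single p 1) x) k =
    (\<Sum>p\<in>Poly_Mapping.keys x. if p = k then Poly_Mapping.lookup x p else 0)"
    by (auto simp: lin_ext_def lookup_sum scale_one_right lookup_single when_def intro!: sum.cong)
  then show "Poly_Mapping.lookup (lin_ext (\<lambda>p. Poly_Mapping.single p 1) x) k = Poly_Mapping.lookup x k"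
    by (simp add: in_keys_iff)
qed

lemma linear_eq_on_basis:
  assumes "Vector_Spaces.linear scale scale f" "Vector_Spaces.linear scale scale f'"
    and eq: "\<And>p. f (Poly_Mapping.single p 1) = f' (Poly_Mapping.single p 1)"
  shows "f x = f' x"
proof -
  interpret f: Vector_Spaces.linear scale scale f by fact
  interpret f': Vector_Spaces.linear scale scale f' by fact
  have "f (lin_ext (\<lambda>p. Poly_Mapping.single p 1) x) = f' (lin_ext (\<lambda>p. Poly_Mapping.single p 1) x)"
    unfolding lin_ext_def by (simp add: f.sum f'.sum f.scale f'.scale eq)
  then show ?thesis
    by (simp add: lin_ext_basis)
qed

text \<open>Evaluation at the first test index is a linear functional that kills all later vectors,
  hence their span, but not the first vector. So the first vector lies outside that span, and
  induction does the rest.\<close>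

lemma independent_triangular:
  assumes "length ts = length xs"
    and "\<And>i. i < length xs \<Longrightarrow> Poly_Mapping.lookup (xs ! i) (ts ! i) \<noteq> (0::'k::field)"
    and "\<And>i j. \<lbrakk>i < j; j < length xs\<rbrakk> \<Longrightarrow> Poly_Mapping.lookup (xs ! j) (ts ! i) = 0"
  shows "distinct xs \<and> vs.independent (set xs)"
  using assms
proof (induction ts xs rule: list_induct2)
  case Nil
  then show ?case by (simp add: vs.independent_empty)
next
  case (Cons t ts x xs)
  have IH: "distinct xs" "vs.independent (set xs)"
    using Cons.IH Cons.prems(1)[of "Suc _"] Cons.prems(2)[of "Suc _" "Suc _"] by simp_all
  have x: "Poly_Mapping.lookup x t \<noteq> 0"
    using Cons.prems(1)[of 0] by simp
  have "\<forall>y\<in>set xs. Poly_Mapping.lookup y t = 0"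
    using Cons.prems(2)[of 0 "Suc _"] by (auto simp: in_set_conv_nth)
  then have "vs.span (set xs) \<subseteq> {y. Poly_Mapping.lookup y t = 0}"
    by (intro vs.span_minimal) (auto simp: vs.subspace_def lookup_add lookup_scale)
  then have "x \<notin> vs.span (set xs)"
    using x by blast
  then show ?case
    using IH vs.span_base[of x "set xs"] vs.independent_insertI[of x "set xs"] by auto
qed

section \<open>Concatenation, thin splits and the recursion in the last arrow\<close>

lemma lookup_concat_arrow:
  "Poly_Mapping.lookup (concat_arrow G g x y) (h, as) =
     (if as \<noteq> [] \<and> path_target G g (h, butlast as) = arrow_source (last as)
      then Poly_Mapping.lookup x (h, butlast as) * Poly_Mapping.lookup y (last as) else 0)"
proof -
  let ?p = "(h, butlast as)" and ?a = "last as"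
  let ?c = "if path_target G g ?p = arrow_source ?a
    then Poly_Mapping.lookup x ?p * Poly_Mapping.lookup y ?a else 0"
  \<comment> \<open>Only the pair \<open>?p\<close>, \<open>?a\<close> can produce the path
    \<open>(h, as)\<close>, so the double sum collapses to one term; for \<open>as = []\<close> no
    pair does, whatever \<open>last []\<close> is.\<close>
  have "Poly_Mapping.lookup (concat_arrow G g x y) (h, as) =
    (\<Sum>p\<in>Poly_Mapping.keys x. \<Sum>a\<in>Poly_Mapping.keys y.
      if p = ?p \<and> a = ?a \<and> as \<noteq> [] then ?c else 0)"
    unfolding concat_arrow_def lookup_sum
    by (intro sum.cong refl) (auto simp: lookup_single when_def split: if_splits)
  also have "\<dots> = (\<Sum>p\<in>Poly_Mapping.keys x. if p = ?p then
      (\<Sum>a\<in>Poly_Mapping.keys y. if a = ?a then if as \<noteq> [] then ?c else 0 else 0) else 0)"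
    by (intro sum.cong refl) (auto intro!: sum.cong)
  finally show ?thesis
    by (auto simp: in_keys_iff)
qed

lemma concat_arrow_sum:
  "concat_arrow G g (sum f A) y = (\<Sum>i\<in>A. concat_arrow G g (f i) y)"
proof (rule poly_mapping_eqI)
  fix p :: "'a path"
  show "Poly_Mapping.lookup (concat_arrow G g (sum f A) y) p =
    Poly_Mapping.lookup (\<Sum>i\<in>A. concat_arrow G g (f i) y) p"
    by (cases p) (simp add: lookup_sum lookup_concat_arrow sum_distrib_right)
qed

lemma thin_entry_insert_above:
  assumes "i \<le> N"
  shows "thin_entry G g p (insert (Suc N) e) i = thin_entry G g p e i"
proof -
  have "{j \<in> insert (Suc N) e. j < i} = {j \<in> e. j < i}"
    using assms by auto
  then show ?thesis
    using assms by (simp add: thin_entry_def Let_def)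
qed

text \<open>With \<open>length as\<close> positions for arrows, the split never reaches
  \<open>a\<close>: at an arrow position fewer than \<open>length as\<close> arrows are used up, and
  a vertex after at most \<open>length as\<close> arrows depends on these alone.\<close>

lemma thin_entry_butlast:
  assumes "finite e" "card e = length as"
  shows "thin_entry G g (h, as @ [a]) e i = thin_entry G g (h, as) e i"
proof -
  let ?r = "card {j \<in> e. j < i}"
  have "path_vertex G g (h, as @ [a]) r = path_vertex G g (h, as) r" if "r \<le> length as" for r
    using that by (cases r) (auto simp: nth_append)
  moreover have "?r \<le> length as"
    using card_mono[of e "{j \<in> e. j < i}"] assms by auto
  ultimately have v: "path_vertex G g (h, as @ [a]) ?r = path_vertex G g (h, as) ?r"
    by blast
  have "?r < length as" if "i \<in> e"
    using psubset_card_mono[of e "{j \<in> e. j < i}"] assms that by auto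
  then show ?thesis
    using v by (auto simp: thin_entry_def Let_def nth_append)
qed

lemma thin_entry_last_vertex:
  assumes "e \<subseteq> {1..N}" "card e = path_length p"
  shows "thin_entry G g p e (Suc N) = Vertex_Entry (path_target G g p)"
proof -
  have "{j \<in> e. j < Suc N} = e" "Suc N \<notin> e"
    using assms(1) by auto
  then show ?thesis
    using assms(2) by (simp add: thin_entry_def path_target_def Let_def)
qed

lemma thin_entry_last_arrow:
  assumes "e \<subseteq> {1..N}" "card e = length as"
  shows "thin_entry G g (h, as @ [a]) (insert (Suc N) e) (Suc N) = Arrow_Entry a"
proof -
  have "{j \<in> insert (Suc N) e. j < Suc N} = e"
    using assms(1) by auto
  then show ?thesis
    using assms(2) by (simp add: thin_entry_def Let_def)
qed

abbreviation (input) thin_term where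
  "thin_term G g act p q N d \<equiv>
     foldl (concat_arrow G g) (Poly_Mapping.single (fst p \<otimes>\<^bsub>G\<^esub> fst q, []) 1)
       (map (\<lambda>i. entry_mult G act (thin_entry G g p d i) (thin_entry G g q ({1..N} - d) i)) [1..<Suc N])"

text \<open>\<open>Suc N\<close> is not in \<open>d\<close>, so the final entry is the last arrow of
  the right path. The left path has been traversed by then, and its target acts on this
  arrow.\<close>

lemma thin_term_last_right:
  assumes d: "d \<subseteq> {1..N}" "card d = path_length p" "N = path_length p + length bs"
  shows "thin_term G g act p (l, bs @ [b]) (Suc N) d =
    concat_arrow G g (thin_term G g act p (l, bs) N d) (arrow_lact G (path_target G g p) b)"
proof -
  have c: "{1..Suc N} - d = insert (Suc N) ({1..N} - d)"
    using d by auto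
  have fin: "finite d"
    using d(1) finite_subset by blast
  have card: "card ({1..N} - d) = length bs"
    using d fin by (simp add: card_Diff_subset)
  have "thin_entry G g (l, bs @ [b]) ({1..Suc N} - d) i = thin_entry G g (l, bs) ({1..N} - d) i"
    if "i \<in> set [1..<Suc N]" for i
  proof -
    have "i \<le> N"
      using that by auto
    then show ?thesis
      unfolding c by (simp only: thin_entry_insert_above thin_entry_butlast[OF _ card] finite_Diff finite_atLeastAtMost)
  qed
  moreover have "thin_entry G g (l, bs @ [b]) ({1..Suc N} - d) (Suc N) = Arrow_Entry b"
    unfolding c by (rule thin_entry_last_arrow) (use card in auto)
  moreover have "thin_entry G g p d (Suc N) = Vertex_Entry (path_target G g p)"
    by (rule thin_entry_last_vertex) (use d in auto)
  moreover have "[1..<Suc (Suc N)] = [1..<Suc N] @ [Suc N]"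
    by simp
  ultimately show ?thesis
    by (simp only: map_append foldl_append list.map foldl.simps entry_mult.simps fst_conv cong: map_cong)
qed

text \<open>Mirror image: the final entry is the last arrow of the left path, acted on from the
  right by the target of the whole right path. This action is the source of the twist.\<close>

lemma thin_term_last_left:
  assumes d: "d \<subseteq> {1..N}" "card d = length as" "N = length as + path_length q"
  shows "thin_term G g act (h, as @ [a]) q (Suc N) (insert (Suc N) d) =
    concat_arrow G g (thin_term G g act (h, as) q N d) (arrow_ract G act a (path_target G g q))"
proof -
  have c: "{1..Suc N} - insert (Suc N) d = {1..N} - d"
    using d by auto
  have fin: "finite d"
    using d(1) finite_subset by blast
  have card: "card ({1..N} - d) = path_length q"
    using d fin by (simp add: card_Diff_subset)
  have "thin_entry G g (h, as @ [a]) (insert (Suc N) d) i = thin_entry G g (h, as) d i"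
    if "i \<in> set [1..<Suc N]" for i
  proof -
    have "i \<le> N"
      using that by auto
    then show ?thesis
      by (simp only: thin_entry_insert_above thin_entry_butlast[OF fin d(2)])
  qed
  moreover have "thin_entry G g (h, as @ [a]) (insert (Suc N) d) (Suc N) = Arrow_Entry a"
    by (rule thin_entry_last_arrow) (use d in auto)
  moreover have "thin_entry G g q ({1..N} - d) (Suc N) = Vertex_Entry (path_target G g q)"
    by (rule thin_entry_last_vertex) (use card in auto)
  moreover have "[1..<Suc (Suc N)] = [1..<Suc N] @ [Suc N]"
    by simp
  ultimately show ?thesis
    by (simp only: c map_append foldl_append list.map foldl.simps entry_mult.simps fst_conv cong: map_cong)
qed

lemma path_mult_vertices:
  "path_mult G g act (h, []) (l, []) = Poly_Mapping.single (h \<otimes>\<^bsub>G\<^esub> l, []) 1"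
proof -
  have "{d. d \<subseteq> {1..0::nat} \<and> card d = 0} = {{}}"
    by auto
  then show ?thesis
    by (simp add: path_mult_def path_length_def Let_def)
qed

text \<open>Split the sum over \<open>d\<close> according to which factor contributes the last arrow.\<close>

lemma path_mult_step:
  assumes "as \<noteq> [] \<or> bs \<noteq> []"
  shows "path_mult G g act (h, as) (l, bs) =
    (if as = [] then 0 else concat_arrow G g (path_mult G g act (h, butlast as) (l, bs))
       (arrow_ract G act (last as) (path_target G g (l, bs)))) +
    (if bs = [] then 0 else concat_arrow G g (path_mult G g act (h, as) (l, butlast bs))
       (arrow_lact G (path_target G g (h, as)) (last bs)))"
proof -
  define D where "D m N = {d. d \<subseteq> {1..N} \<and> card d = m}" for m N :: nat
  define t where "t as bs N d = thin_term G g act (h, as) (l, bs) N d" for as bs N d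
  have pm: "path_mult G g act (h, as) (l, bs) = sum (t as bs N) (D (length as) N)"
    if "N = length as + length bs" for as bs N
    unfolding path_mult_def D_def t_def that by (simp add: path_length_def Let_def)
  obtain N where N: "length as + length bs = Suc N"
    using assms by (cases "length as + length bs") auto
  have finD: "finite (D m N)" for m N
    unfolding D_def by (rule finite_subset[of _ "Pow {1..N}"]) auto
  let ?L = "{d \<in> D (length as) (Suc N). Suc N \<in> d}"
  \<comment> \<open>The sets avoiding \<open>Suc N\<close> are exactly those in
    \<open>D (length as) N\<close>; for them the last arrow comes from the right factor.\<close>
  have split: "D (length as) (Suc N) = ?L \<union> D (length as) N"
    unfolding D_def by (auto simp: subset_iff le_Suc_eq)
  have disj: "?L \<inter> D (length as) N = {}"
    unfolding D_def by (auto simp: subset_iff)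
  have left: "sum (t as bs (Suc N)) ?L = (if as = [] then 0 else
      concat_arrow G g (path_mult G g act (h, butlast as) (l, bs))
       (arrow_ract G act (last as) (path_target G g (l, bs))))"
  proof (cases as rule: rev_cases)
    case Nil
    then have "?L = {}"
      unfolding D_def by (auto dest: finite_subset)
    with Nil show ?thesis
      by (simp only: sum.empty if_True refl)
  next
    case (snoc as' a)
    have inj: "inj_on (insert (Suc N)) (D (length as') N)"
    proof (rule inj_onI)
      fix x y assume xy: "x \<in> D (length as') N" "y \<in> D (length as') N" "insert (Suc N) x = insert (Suc N) y"
      then have "Suc N \<notin> x" "Suc N \<notin> y"
        by (auto simp: D_def subset_iff)
      then show "x = y"
        using xy(3) by (rule insert_ident[THEN iffD1])
    qed
    have "?L = insert (Suc N) ` D (length as') N"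
    proof (intro equalityI subsetI)
      fix d assume d: "d \<in> ?L"
      then have f: "finite d" and n: "Suc N \<in> d"
        unfolding D_def by (auto dest: finite_subset)
      have "d - {Suc N} \<in> D (length as') N"
        using d n f snoc unfolding D_def by (auto simp: le_Suc_eq)
      moreover have "d = insert (Suc N) (d - {Suc N})"
        using n by auto
      ultimately show "d \<in> insert (Suc N) ` D (length as') N"
        by blast
    next
      fix d assume "d \<in> insert (Suc N) ` D (length as') N"
      then obtain e where e: "d = insert (Suc N) e" "e \<subseteq> {1..N}" "card e = length as'"
        unfolding D_def by auto
      then have "finite e" "Suc N \<notin> e"
        by (auto dest: finite_subset)
      then show "d \<in> ?L"
        using e snoc unfolding D_def by (auto simp: subset_iff)
    qed
    then have "sum (t as bs (Suc N)) ?L = (\<Sum>d\<in>D (length as') N. t as bs (Suc N) (insert (Suc N) d))"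
      using inj by (simp add: sum.reindex)
    also have "\<dots> = (\<Sum>d\<in>D (length as') N. concat_arrow G g (t as' bs N d)
        (arrow_ract G act a (path_target G g (l, bs))))"
      unfolding t_def snoc
      by (rule sum.cong[OF refl], rule thin_term_last_left)
        (use N snoc in \<open>auto simp: D_def path_length_def\<close>)
    also have "\<dots> = concat_arrow G g (path_mult G g act (h, as') (l, bs))
        (arrow_ract G act a (path_target G g (l, bs)))"
      using N snoc by (simp add: pm[of N] concat_arrow_sum)
    finally show ?thesis
      using snoc by simp
  qed
  have right: "sum (t as bs (Suc N)) (D (length as) N) = (if bs = [] then 0 else
      concat_arrow G g (path_mult G g act (h, as) (l, butlast bs))
       (arrow_lact G (path_target G g (h, as)) (last bs)))"
  proof (cases bs rule: rev_cases)
    case Nil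
    \<comment> \<open>With \<open>bs\<close> empty, \<open>d\<close> would have \<open>Suc N\<close>
      elements inside \<open>{1..N}\<close>.\<close>
    have "d \<notin> D (length as) N" for d
      using Nil N card_mono[of "{1..N}" d] unfolding D_def by auto
    then have "D (length as) N = {}"
      by auto
    with Nil show ?thesis
      by (simp only: sum.empty if_True refl)
  next
    case (snoc bs' b)
    have "sum (t as bs (Suc N)) (D (length as) N) =
      (\<Sum>d\<in>D (length as) N. concat_arrow G g (t as bs' N d) (arrow_lact G (path_target G g (h, as)) b))"
      unfolding t_def snoc
      by (rule sum.cong[OF refl], rule thin_term_last_right)
        (use N snoc in \<open>auto simp: D_def path_length_def\<close>)
    also have "\<dots> = concat_arrow G g (path_mult G g act (h, as) (l, bs'))
        (arrow_lact G (path_target G g (h, as)) b)"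
      using N snoc by (simp add: pm[of N] concat_arrow_sum)
    finally show ?thesis
      using snoc by simp
  qed
  have "path_mult G g act (h, as) (l, bs) = sum (t as bs (Suc N)) (?L \<union> D (length as) N)"
    using pm[of "Suc N" as bs] N split by simp
  also have "\<dots> = sum (t as bs (Suc N)) ?L + sum (t as bs (Suc N)) (D (length as) N)"
    by (rule sum.union_disjoint) (use finD disj in auto)
  finally show ?thesis
    by (simp only: left right)
qed

section \<open>Twisted shuffles\<close>

text \<open>Here and below words are read backwards: the head of the list is the last arrow of the path. The
  twist \<open>deg_weight\<close> comes from \<open>v\<^sub>2 \<cdot> g\<^sup>s = v\<^sub>2 + s v\<^sub>1\<close>.\<close>

definition deg_weight :: "(vbasis list \<Rightarrow> 'k::comm_ring_1) \<Rightarrow> vbasis list \<Rightarrow> 'k" where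
  "deg_weight H w = of_nat (length w) * H w"

text \<open>\<open>F\<close> and \<open>H\<close> are coefficient functions of the left and right
  factor. The letter \<open>c\<close>, last in the path, stems from the right factor, from the left
  factor unchanged, or, for \<open>c = V1\<close>, from a letter \<open>V2\<close> of the left
  factor that has passed all letters of the right factor; \<open>deg_weight\<close> counts
  these.\<close>

fun tw_shuffle ::
  "(vbasis list \<Rightarrow> 'k::comm_ring_1) \<Rightarrow> (vbasis list \<Rightarrow> 'k) \<Rightarrow> vbasis list \<Rightarrow> 'k" where
  "tw_shuffle F H [] = F [] * H []"
| "tw_shuffle F H (c # z) =
     tw_shuffle F (\<lambda>w. H (c # w)) z + tw_shuffle (\<lambda>w. F (c # w)) H z +
     (if c = V1 then tw_shuffle (\<lambda>w. F (V2 # w)) (deg_weight H) z else 0)"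

lemma deg_weight_Cons:
  "(\<lambda>w. deg_weight H (c # w)) = (\<lambda>w. H (c # w) + deg_weight (\<lambda>w. H (c # w)) w)"
  by (auto simp: deg_weight_def algebra_simps)

lemma deg_weight_add: "deg_weight (\<lambda>w. H w + H' w) = (\<lambda>w. deg_weight H w + deg_weight H' w)"
  by (auto simp: deg_weight_def algebra_simps)

lemma deg_weight_mult: "deg_weight (\<lambda>w. c * H w) = (\<lambda>w. c * deg_weight H w)"
  by (auto simp: deg_weight_def algebra_simps)

lemma deg_weight_zero: "deg_weight (\<lambda>w. 0) = (\<lambda>w. 0)"
  by (auto simp: deg_weight_def)

lemma tw_shuffle_add_left:
  "tw_shuffle (\<lambda>w. F w + F' w) H z = tw_shuffle F H z + tw_shuffle F' H z"
  by (induction z arbitrary: F F' H) (auto simp: algebra_simps)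

lemma tw_shuffle_add_right:
  "tw_shuffle F (\<lambda>w. H w + H' w) z = tw_shuffle F H z + tw_shuffle F H' z"
  by (induction z arbitrary: F H H') (auto simp: algebra_simps deg_weight_add)

lemma tw_shuffle_mult_left: "tw_shuffle (\<lambda>w. c * F w) H z = c * tw_shuffle F H z"
  by (induction z arbitrary: F H) (auto simp: algebra_simps)

lemma tw_shuffle_mult_right: "tw_shuffle F (\<lambda>w. c * H w) z = c * tw_shuffle F H z"
  by (induction z arbitrary: F H) (auto simp: algebra_simps deg_weight_mult)

lemma tw_shuffle_zero_left [simp]: "tw_shuffle (\<lambda>w. 0) H z = 0"
  by (induction z arbitrary: H) auto

lemma tw_shuffle_zero_right [simp]: "tw_shuffle F (\<lambda>w. 0) z = 0"
  by (induction z arbitrary: F) (auto simp: deg_weight_zero)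

lemma tw_shuffle_sum_left:
  "tw_shuffle (\<lambda>w. \<Sum>p\<in>A. f p w) H z = (\<Sum>p\<in>A. tw_shuffle (f p) H z)"
  by (induction A rule: infinite_finite_induct) (auto simp: tw_shuffle_add_left)

lemma tw_shuffle_sum_right:
  "tw_shuffle F (\<lambda>w. \<Sum>p\<in>A. f p w) z = (\<Sum>p\<in>A. tw_shuffle F (f p) z)"
  by (induction A rule: infinite_finite_induct) (auto simp: tw_shuffle_add_right)

text \<open>The product adds lengths, so weighting by the length is a derivation.\<close>

lemma deg_weight_tw_shuffle:
  "deg_weight (tw_shuffle F H) z = tw_shuffle (deg_weight F) H z + tw_shuffle F (deg_weight H) z"
proof (induction z arbitrary: F H)
  case Nil
  then show ?case by (simp add: deg_weight_def)
next
  case (Cons c z)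
  have "deg_weight (tw_shuffle F H) (c # z) =
      tw_shuffle F H (c # z) + of_nat (length z) * tw_shuffle F H (c # z)"
    by (simp add: deg_weight_def algebra_simps)
  also have "of_nat (length z) * tw_shuffle F H (c # z) =
      deg_weight (tw_shuffle F (\<lambda>w. H (c # w))) z + deg_weight (tw_shuffle (\<lambda>w. F (c # w)) H) z +
      (if c = V1 then deg_weight (tw_shuffle (\<lambda>w. F (V2 # w)) (deg_weight H)) z else 0)"
    by (simp add: deg_weight_def[of _ z] algebra_simps)
  finally show ?case
    by (simp add: Cons.IH deg_weight_Cons tw_shuffle_add_left tw_shuffle_add_right algebra_simps)
qed

text \<open>Both sides are expanded at the letter \<open>c\<close>. For \<open>c = V1\<close> the
  twisted term on the left involves \<open>deg_weight (tw_shuffle H K)\<close>; the derivation rule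
  splits it into the terms that arise on the right from moving a letter of \<open>F\<close> past
  \<open>H\<close> and past \<open>K\<close>.\<close>

lemma tw_shuffle_assoc:
  "tw_shuffle F (tw_shuffle H K) z = tw_shuffle (tw_shuffle F H) K z"
proof (induction z arbitrary: F H K)
  case Nil
  then show ?case by simp
next
  case (Cons c z)
  have dw: "deg_weight (tw_shuffle H K) =
      (\<lambda>z. tw_shuffle (deg_weight H) K z + tw_shuffle H (deg_weight K) z)" for H K :: "vbasis list \<Rightarrow> 'a"
    by (rule ext) (rule deg_weight_tw_shuffle)
  show ?case
    by (cases "c = V1")
      (simp_all add: Cons.IH dw tw_shuffle_add_left tw_shuffle_add_right algebra_simps)
qed

section \<open>Indicator functions of words and the grading\<close>

definition word_delta :: "vbasis list \<Rightarrow> vbasis list \<Rightarrow> 'k::comm_ring_1" where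
  "word_delta u z = of_bool (z = u)"

lemma word_delta_Nil_Cons: "(\<lambda>w. word_delta [] (c # w)) = (\<lambda>w. 0)"
  by (simp add: word_delta_def fun_eq_iff)

lemma word_delta_Cons_Cons: "(\<lambda>w. word_delta (x # u) (c # w)) = (\<lambda>w. of_bool (x = c) * word_delta u w)"
  by (auto simp add: word_delta_def fun_eq_iff)

lemma deg_weight_word_delta: "deg_weight (word_delta u) = (\<lambda>w. of_nat (length u) * word_delta u w)"
  by (auto simp add: deg_weight_def word_delta_def fun_eq_iff)

lemma tw_shuffle_one_left: "tw_shuffle (word_delta []) H z = H z"
  by (induction z arbitrary: H) (simp_all add: word_delta_Nil_Cons word_delta_def[of "[]" "[]"])

lemma tw_shuffle_one_right: "tw_shuffle H (word_delta []) z = H z"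
  by (induction z arbitrary: H)
    (simp_all add: word_delta_Nil_Cons word_delta_def[of "[]" "[]"] deg_weight_word_delta)

text \<open>The product is graded by length. Powers of \<open>g\<close> with different exponents may
  coincide, so vertices alone cannot rule out words of the wrong length; this lemma does.\<close>

lemma tw_shuffle_word_delta_length:
  assumes "length z \<noteq> length u + length v"
  shows "tw_shuffle (word_delta u) (word_delta v) z = 0"
  using assms
proof (induction z arbitrary: u v)
  case Nil
  then show ?case by (auto simp: word_delta_def)
next
  case (Cons c z)
  show ?case
    using Cons.prems
    by (cases u; cases v)
      (auto simp: word_delta_Nil_Cons word_delta_Cons_Cons deg_weight_word_delta tw_shuffle_mult_left
        tw_shuffle_mult_right Cons.IH)
qed

section \<open>Paths starting at the identity as words\<close>

locale nichols_setup = group G for G :: "('g, 'm) monoid_scheme" (structure) +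
  fixes g :: 'g and act :: "(vbasis \<Rightarrow>\<^sub>0 'k::field) \<Rightarrow> 'g \<Rightarrow> (vbasis \<Rightarrow>\<^sub>0 'k)"
  assumes g_closed [simp]: "g \<in> carrier G"
    and right_module: "right_module G act"
    and act_V1: "act (basis_vec V1) g = basis_vec V1"
    and act_V2: "act (basis_vec V2) g = basis_vec V1 + basis_vec V2"
begin

lemma act_linear: "h \<in> carrier G \<Longrightarrow> Vector_Spaces.linear scale scale (\<lambda>v. act v h)"
  using right_module by (simp add: right_module_def)

lemma act_V1_pow: "act (basis_vec V1) (g [^] (s::nat)) = basis_vec V1"
  using right_module by (induction s) (simp_all add: right_module_def act_V1)

lemma act_V2_pow:
  "act (basis_vec V2) (g [^] (s::nat)) = basis_vec V2 + Poly_Mapping.single V1 (of_nat s)"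
proof (induction s)
  case 0
  then show ?case
    using right_module by (simp add: right_module_def)
next
  case (Suc s)
  interpret g: Vector_Spaces.linear scale scale "\<lambda>v. act v g"
    by (rule act_linear) simp
  have "act (basis_vec V2) (g [^] Suc s) = act (act (basis_vec V2) (g [^] s)) g"
    using right_module by (simp add: right_module_def)
  also have "\<dots> = act (basis_vec V2) g + act (scale (of_nat s) (basis_vec V1)) g"
    unfolding Suc scale_one_right[symmetric, of V1 "of_nat s"] g.add ..
  also have "\<dots> = basis_vec V2 + Poly_Mapping.single V1 (of_nat (Suc s))"
    unfolding g.scale act_V1 act_V2 by (simp add: scale_one_right single_add add_ac)
  finally show ?case .
qed

text \<open>The list is read backwards: its head becomes the last arrow, which starts at the vertex
  reached after \<open>length z\<close> steps. Recursion on the list thus removes the last arrow, as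
  in \<open>path_mult_step\<close>.\<close>

primrec word_arrows :: "vbasis list \<Rightarrow> 'g arrow list" where
  "word_arrows [] = []"
| "word_arrows (c # z) = word_arrows z @ [Arrow (g [^] length z) c]"

definition word_path :: "vbasis list \<Rightarrow> 'g path" where
  "word_path z = (\<one>, word_arrows z)"

lemma length_word_arrows [simp]: "length (word_arrows z) = length z"
  by (induction z) auto

lemma word_arrows_eq_Nil [simp]: "word_arrows z = [] \<longleftrightarrow> z = []"
  by (cases z) auto

lemma word_arrows_inject [simp]: "word_arrows u = word_arrows z \<longleftrightarrow> u = z"
proof (induction u arbitrary: z)
  case Nil
  then show ?case by (cases z) auto
next
  case (Cons a u)
  then show ?case by (cases z) auto
qed

lemma word_path_inject [simp]: "word_path u = word_path z \<longleftrightarrow> u = z"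
  by (simp add: word_path_def)

lemma path_target_word: "path_target G g (\<one>, word_arrows z) = g [^] length z"
  by (cases z) (auto simp: path_target_def path_length_def arrow_target_def nth_append)

lemma word_path_in_paths: "word_path z \<in> paths G g"
proof -
  \<comment> \<open>Trailing arrows \<open>as\<close> are allowed because \<open>word_arrows\<close>
    appends on the right, and the induction hypothesis has to apply in front of the appended
    arrow.\<close>
  have "path_vertex G g (\<one>, word_arrows z @ as) r = g [^] r" if "r \<le> length z" for z r as
    using that
  proof (induction z arbitrary: as r)
    case Nil
    then show ?case by simp
  next
    case (Cons c z)
    show ?case
    proof (cases "r \<le> length z")
      case True
      then show ?thesis
        using Cons.IH[of r "Arrow (g [^] length z) c # as"] by simp
    next
      case False
      then have "r = Suc (length z)"
        using Cons.prems by simp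
      then show ?thesis
        by (simp add: arrow_target_def nth_append)
    qed
  qed
  from this[of _ _ "[]"] have v: "path_vertex G g (\<one>, word_arrows z) r = g [^] r" if "r \<le> length z" for z r
    using that by simp
  have "arrow_source (word_arrows z ! r) = g [^] r" if "r < length z" for r
    using that by (induction z) (auto simp: nth_append less_Suc_eq)
  then show ?thesis
    by (simp add: paths_def word_path_def path_length_def v)
qed

lemma lookup_tensor:
  "Poly_Mapping.lookup (tensor h v) (Arrow l c) = (if h = l then Poly_Mapping.lookup v c else 0)"
  by (cases c) (auto simp: tensor_def lookup_add lookup_single when_def)

text \<open>The second summand is the multiple of \<open>V1\<close> that \<open>V2\<close> picks up
  under the power \<open>g [^] s\<close>.\<close>

lemma lookup_arrow_ract_word:
  "Poly_Mapping.lookup (arrow_ract G act (Arrow (g [^] (m::nat)) x) (g [^] (s::nat))) (Arrow (g [^] (m + s)) c) =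
    of_bool (x = c) + of_bool (x = V2 \<and> c = V1) * of_nat s"
  by (cases x; cases c) (simp_all add: arrow_ract_def lookup_tensor nat_pow_mult act_V1_pow act_V2_pow lookup_add lookup_single)

lemma lookup_arrow_lact_word:
  "Poly_Mapping.lookup (arrow_lact G (g [^] (m::nat)) (Arrow (g [^] (s::nat)) y)) (Arrow (g [^] (m + s)) c) =
    of_bool (y = c)"
  by (cases y; cases c) (simp_all add: arrow_lact_def lookup_tensor nat_pow_mult lookup_single)

lemma path_mult_word_step:
  assumes "u \<noteq> [] \<or> v \<noteq> []"
  shows "path_mult G g act (word_path u) (word_path v) =
    (case u of [] \<Rightarrow> 0 | x # u' \<Rightarrow> concat_arrow G g (path_mult G g act (word_path u') (word_path v))
       (arrow_ract G act (Arrow (g [^] length u') x) (g [^] length v))) +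
    (case v of [] \<Rightarrow> 0 | y # v' \<Rightarrow> concat_arrow G g (path_mult G g act (word_path u) (word_path v'))
       (arrow_lact G (g [^] length u) (Arrow (g [^] length v') y)))"
  using assms unfolding word_path_def
  by (subst path_mult_step) (auto simp: path_target_word path_target_word[of "[]", simplified] split: list.splits)

lemma lookup_concat_word_Cons:
  "Poly_Mapping.lookup (concat_arrow G g x y) (word_path (c # z)) =
     Poly_Mapping.lookup x (word_path z) * Poly_Mapping.lookup y (Arrow (g [^] length z) c)"
  by (simp add: word_path_def lookup_concat_arrow path_target_word)

lemma lookup_concat_word_Nil: "Poly_Mapping.lookup (concat_arrow G g x y) (word_path []) = 0"
  by (simp add: word_path_def lookup_concat_arrow)

text \<open>Both sides satisfy the same recursion in the last letter. A last letter from
  \<open>u\<close> has been acted on by \<open>g [^] length v\<close>, and \<open>length v\<close>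
  is also the factor by which \<open>deg_weight\<close> scales \<open>word_delta v\<close>.\<close>

lemma lookup_path_mult_word:
  "Poly_Mapping.lookup (path_mult G g act (word_path u) (word_path v)) (word_path z) =
    tw_shuffle (word_delta u) (word_delta v) z"
proof (induction z arbitrary: u v)
  case Nil
  show ?case
  proof (cases "u = [] \<and> v = []")
    case True
    then show ?thesis
      by (simp add: word_path_def path_mult_vertices word_delta_def)
  next
    case False
    then show ?thesis
      by (subst path_mult_word_step)
        (auto simp: lookup_add lookup_concat_word_Nil word_delta_def split: list.splits)
  qed
next
  case (Cons c z)
  show ?case
  proof (cases "u = [] \<and> v = []")
    case True
    then show ?thesis
      by (simp add: word_path_def path_mult_vertices word_delta_Nil_Cons deg_weight_word_delta lookup_single when_def)
  next
    case False
    have left: "Poly_Mapping.lookup (concat_arrow G g (path_mult G g act (word_path u') (word_path v))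
        (arrow_ract G act (Arrow (g [^] length u') x) (g [^] length v))) (word_path (c # z)) =
      (of_bool (x = c) + of_bool (x = V2 \<and> c = V1) * of_nat (length v)) *
        tw_shuffle (word_delta u') (word_delta v) z" for x u'
    \<comment> \<open>\<open>lookup_arrow_ract_word\<close> applies to arrows with source
      \<open>g [^] (length u' + length v)\<close>; for other lengths the coefficient of the shorter
      product vanishes by the grading.\<close>
    proof (cases "length z = length u' + length v")
      case True
      then show ?thesis
        by (simp only: lookup_concat_word_Cons Cons.IH lookup_arrow_ract_word) (simp add: mult.commute)
    next
      case False
      then show ?thesis
        by (simp add: lookup_concat_word_Cons Cons.IH tw_shuffle_word_delta_length)
    qed
    have right: "Poly_Mapping.lookup (concat_arrow G g (path_mult G g act (word_path u) (word_path v'))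
        (arrow_lact G (g [^] length u) (Arrow (g [^] length v') y))) (word_path (c # z)) =
      of_bool (y = c) * tw_shuffle (word_delta u) (word_delta v') z" for y v'
    proof (cases "length z = length u + length v'")
      case True
      then show ?thesis
        by (simp only: lookup_concat_word_Cons Cons.IH lookup_arrow_lact_word) (simp add: mult.commute)
    next
      case False
      then show ?thesis
        by (simp add: lookup_concat_word_Cons Cons.IH tw_shuffle_word_delta_length)
    qed
    have "Poly_Mapping.lookup (path_mult G g act (word_path u) (word_path v)) (word_path (c # z)) =
      (case u of [] \<Rightarrow> 0 | x # u' \<Rightarrow> (of_bool (x = c) + of_bool (x = V2 \<and> c = V1) * of_nat (length v)) *
        tw_shuffle (word_delta u') (word_delta v) z) +
      (case v of [] \<Rightarrow> 0 | y # v' \<Rightarrow> of_bool (y = c) * tw_shuffle (word_delta u) (word_delta v') z)"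
      unfolding path_mult_word_step[OF False[unfolded de_Morgan_conj]] lookup_add
      by (intro arg_cong2[where f = "(+)"]; (simp only: left right lookup_zero split: list.split; simp))
    also have "\<dots> = tw_shuffle (word_delta u) (word_delta v) (c # z)"
      by (cases u; cases v)
        (auto simp: word_delta_Nil_Cons word_delta_Cons_Cons deg_weight_word_delta
          tw_shuffle_mult_left tw_shuffle_mult_right tw_shuffle_add_right algebra_simps)
    finally show ?thesis .
  qed
qed

text \<open>An arrow that composes with a word path of length \<open>m\<close> must start at
  \<open>g [^] m\<close>, so only its label is free and the result is again a word path.\<close>

lemma keys_concat_word:
  assumes "Poly_Mapping.keys x \<subseteq> range word_path"
  shows "Poly_Mapping.keys (concat_arrow G g x y) \<subseteq> range word_path"
proof
  fix p assume p: "p \<in> Poly_Mapping.keys (concat_arrow G g x y)"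
  obtain h as where has: "p = (h, as)"
    by (cases p)
  have as: "as \<noteq> []" "path_target G g (h, butlast as) = arrow_source (last as)"
      "Poly_Mapping.lookup x (h, butlast as) \<noteq> 0"
    using p unfolding has in_keys_iff lookup_concat_arrow by (auto split: if_splits)
  then have "(h, butlast as) \<in> range word_path"
    using assms by (auto simp: in_keys_iff)
  then obtain z where z: "h = \<one>" "butlast as = word_arrows z"
    by (auto simp: word_path_def)
  have "last as = Arrow (g [^] length z) (arrow_label (last as))"
    using as(2) by (cases "last as") (simp add: z path_target_word)
  then have "as = word_arrows (arrow_label (last as) # z)"
    using append_butlast_last_id[OF as(1)] z(2) by simp
  then show "p \<in> range word_path"
    unfolding has z(1) word_path_def by blast
qed

lemma keys_path_mult_word:
  "Poly_Mapping.keys (path_mult G g act (word_path u) (word_path v)) \<subseteq> range word_path"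
proof (induction "length u + length v" arbitrary: u v)
  case 0
  then show ?case
    by (auto simp: word_path_def path_mult_vertices intro!: image_eqI[of _ _ "[]"])
next
  case (Suc N)
  have sub: "Poly_Mapping.keys (case w of [] \<Rightarrow> 0 | y # v \<Rightarrow> concat_arrow G g (f v) (t y v)) \<subseteq> range word_path"
    if "\<And>y v. w = y # v \<Longrightarrow> Poly_Mapping.keys (f v) \<subseteq> range word_path" for w t
      and f :: "vbasis list \<Rightarrow> 'g path \<Rightarrow>\<^sub>0 'k"
  proof (cases w)
    case (Cons y v)
    then show ?thesis
      using keys_concat_word[OF that[OF Cons]] by simp
  qed simp
  have "u \<noteq> [] \<or> v \<noteq> []"
    using Suc.hyps(2) by auto
  then show ?case
    unfolding path_mult_word_step[OF \<open>u \<noteq> [] \<or> v \<noteq> []\<close>]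
    by (intro order_trans[OF keys_add] Un_least sub Suc.hyps(1)) (use Suc.hyps(2) in auto)
qed

end

section \<open>The map from the tensor algebra\<close>

lemma path_algebra_mult_lin_ext:
  "x \<otimes>\<^bsub>path_algebra G g act\<^esub> y = lin_ext (\<lambda>p. lin_ext (path_mult G g act p) y) x"
  by (simp add: path_algebra_def lin_ext_def vs.scale_sum_right)

lemma lin_ext_fun_add: "lin_ext (\<lambda>p. f p + f' p) x = lin_ext f x + lin_ext f' x"
  by (simp add: lin_ext_def vs.scale_right_distrib sum.distrib)

lemma lin_ext_fun_scale: "lin_ext (\<lambda>p. scale c (f p)) x = scale c (lin_ext f x)"
  by (simp add: lin_ext_def vs.scale_sum_right mult.commute)

lemma linear_path_algebra_mult_left:
  "Vector_Spaces.linear scale scale (\<lambda>x. x \<otimes>\<^bsub>path_algebra G g act\<^esub> y)"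
  unfolding path_algebra_mult_lin_ext by (rule linear_lin_ext)

lemma linear_path_algebra_mult_right:
  "Vector_Spaces.linear scale scale (\<lambda>y. x \<otimes>\<^bsub>path_algebra G g act\<^esub> y)"
  unfolding path_algebra_mult_lin_ext
  by (rule linear_scaleI) (simp_all add: lin_ext_fun_add lin_ext_fun_scale)

lemma linear_mult_left: "Vector_Spaces.linear scale scale (\<lambda>x. x * (y :: 'w::monoid_add \<Rightarrow>\<^sub>0 'k::field))"
  by (rule linear_scaleI) (simp_all add: scale_def mult_map_scale_conv_mult distrib_right mult.assoc)

text \<open>Scaling is left multiplication by a multiple of the basis element at \<open>0\<close>.
  Such multiples are central even when the algebra is not commutative, which by linearity is checked
  on basis elements.\<close>

lemma scale_mult_right: "(x :: 'w::monoid_add \<Rightarrow>\<^sub>0 'k::field) * scale c y = scale c (x * y)"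
proof -
  have "x * Poly_Mapping.single 0 c = Poly_Mapping.single 0 c * x"
  proof (rule linear_eq_on_basis[of "\<lambda>x. x * Poly_Mapping.single 0 c"])
    show "Vector_Spaces.linear scale scale ((*) (Poly_Mapping.single (0 :: 'w) c))"
      by (rule linear_scaleI)
        (simp_all add: scale_def mult_map_scale_conv_mult distrib_left mult_single mult.commute
          flip: mult.assoc)
  qed (simp_all add: linear_mult_left mult_single)
  then show ?thesis
    by (simp add: scale_def mult_map_scale_conv_mult flip: mult.assoc)
qed

lemma linear_mult_right: "Vector_Spaces.linear scale scale (\<lambda>y. (x :: 'w::monoid_add \<Rightarrow>\<^sub>0 'k::field) * y)"
  by (rule linear_scaleI) (simp_all add: distrib_left scale_mult_right)

lemma linear_compose:
  assumes "Vector_Spaces.linear scale scale f" "Vector_Spaces.linear scale scale h"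
  shows "Vector_Spaces.linear scale scale (\<lambda>x. h (f x))"
  using Vector_Spaces.linear_compose[OF assms] by (simp add: o_def)

context nichols_setup
begin

section \<open>Elements supported on word paths and their coefficient functions\<close>

abbreviation "PA \<equiv> path_algebra G g act"

definition word_supported :: "('g path \<Rightarrow>\<^sub>0 'k) \<Rightarrow> bool" where
  "word_supported x \<longleftrightarrow> Poly_Mapping.keys x \<subseteq> range word_path"

definition coeff :: "('g path \<Rightarrow>\<^sub>0 'k) \<Rightarrow> vbasis list \<Rightarrow> 'k" where
  "coeff x z = Poly_Mapping.lookup x (word_path z)"

lemma word_supported_eqI:
  assumes "word_supported x" "word_supported y" "\<And>z. coeff x z = coeff y z"
  shows "x = y"
proof (rule poly_mapping_eqI)
  fix p
  show "Poly_Mapping.lookup x p = Poly_Mapping.lookup y p"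
  proof (cases "p \<in> range word_path")
    case True
    then show ?thesis
      using assms(3) by (auto simp: coeff_def)
  next
    case False
    then have "p \<notin> Poly_Mapping.keys x" "p \<notin> Poly_Mapping.keys y"
      using assms(1,2) unfolding word_supported_def by blast+
    then show ?thesis
      by (simp add: in_keys_iff)
  qed
qed

lemma word_supported_carrier: "word_supported x \<Longrightarrow> x \<in> carrier PA"
  using word_path_in_paths by (auto simp: word_supported_def path_algebra_def)

lemma word_supported_zero: "word_supported 0"
  by (simp add: word_supported_def)

lemma word_supported_add: "word_supported x \<Longrightarrow> word_supported y \<Longrightarrow> word_supported (x + y)"
  using keys_add[of x y] by (auto simp: word_supported_def)

lemma word_supported_scale: "word_supported x \<Longrightarrow> word_supported (scale c x)"
  by (auto simp: word_supported_def in_keys_iff lookup_scale subset_iff)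

lemma word_supported_single: "word_supported (Poly_Mapping.single (word_path w) c)"
  by (auto simp: word_supported_def)

lemma word_supported_lin_ext:
  assumes "\<And>p. p \<in> Poly_Mapping.keys x \<Longrightarrow> word_supported (f p)"
  shows "word_supported (lin_ext f x)"
proof -
  have "word_supported (\<Sum>p\<in>A. scale (Poly_Mapping.lookup x p) (f p))" if "A \<subseteq> Poly_Mapping.keys x" for A
    using that by (induction A rule: infinite_finite_induct)
      (auto simp: word_supported_zero intro!: word_supported_add word_supported_scale assms)
  then show ?thesis
    by (simp add: lin_ext_def)
qed

lemma word_supported_mult:
  assumes "word_supported x" "word_supported y"
  shows "word_supported (x \<otimes>\<^bsub>PA\<^esub> y)"
  unfolding path_algebra_mult_lin_ext
proof (intro word_supported_lin_ext)
  fix p q assume "p \<in> Poly_Mapping.keys x" "q \<in> Poly_Mapping.keys y"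
  then obtain u v where "p = word_path u" "q = word_path v"
    using assms unfolding word_supported_def by blast
  then show "word_supported (path_mult G g act p q)"
    using keys_path_mult_word by (simp add: word_supported_def)
qed

text \<open>As a finite combination of indicator functions, \<open>coeff x\<close> is open to the
  bilinearity of \<open>tw_shuffle\<close>, which reduces products to single words.
  \<open>the_inv word_path\<close> recovers the word from its path.\<close>

lemma coeff_expand:
  assumes "word_supported x"
  shows "coeff x = (\<lambda>w. \<Sum>p\<in>Poly_Mapping.keys x. Poly_Mapping.lookup x p * word_delta (the_inv word_path p) w)"
proof
  fix w
  have inj: "inj word_path"
    by (auto intro: injI)
  have "(\<Sum>p\<in>Poly_Mapping.keys x. Poly_Mapping.lookup x p * word_delta (the_inv word_path p) w) =
    (\<Sum>p\<in>Poly_Mapping.keys x. if p = word_path w then Poly_Mapping.lookup x p else 0)"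
  proof (rule sum.cong[OF refl])
    fix p assume "p \<in> Poly_Mapping.keys x"
    then obtain u where "p = word_path u"
      using assms unfolding word_supported_def by blast
    then show "Poly_Mapping.lookup x p * word_delta (the_inv word_path p) w =
        (if p = word_path w then Poly_Mapping.lookup x p else 0)"
      using inj by (auto simp: word_delta_def the_inv_f_f)
  qed
  then show "coeff x w = (\<Sum>p\<in>Poly_Mapping.keys x. Poly_Mapping.lookup x p * word_delta (the_inv word_path p) w)"
    by (simp add: coeff_def in_keys_iff)
qed

lemma coeff_mult:
  assumes "word_supported x" "word_supported y"
  shows "coeff (x \<otimes>\<^bsub>PA\<^esub> y) z = tw_shuffle (coeff x) (coeff y) z"
proof -
  have inj: "inj word_path"
    by (auto intro: injI)
  have pq: "Poly_Mapping.lookup (path_mult G g act p q) (word_path z) =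
      tw_shuffle (word_delta (the_inv word_path p)) (word_delta (the_inv word_path q)) z"
    if k: "p \<in> Poly_Mapping.keys x" "q \<in> Poly_Mapping.keys y" for p q
  proof -
    obtain u v where "p = word_path u" "q = word_path v"
      using assms k unfolding word_supported_def by blast
    then show ?thesis
      using inj by (simp add: lookup_path_mult_word the_inv_f_f)
  qed
  have "coeff (x \<otimes>\<^bsub>PA\<^esub> y) z = (\<Sum>p\<in>Poly_Mapping.keys x. \<Sum>q\<in>Poly_Mapping.keys y.
      Poly_Mapping.lookup x p * (Poly_Mapping.lookup y q *
        tw_shuffle (word_delta (the_inv word_path p)) (word_delta (the_inv word_path q)) z))"
    unfolding path_algebra_mult_lin_ext lin_ext_def coeff_def lookup_sum lookup_scale sum_distrib_left
    by (intro sum.cong refl) (simp add: pq)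
  also have "\<dots> = tw_shuffle (coeff x) (coeff y) z"
    unfolding coeff_expand[OF assms(1)] coeff_expand[OF assms(2)]
    by (simp add: tw_shuffle_sum_left tw_shuffle_sum_right tw_shuffle_mult_left tw_shuffle_mult_right
        sum_distrib_left)
  finally show ?thesis .
qed

text \<open>In contrast to the words of \<open>word_path\<close>, this list is a monomial in its
  usual order: the head is the leftmost factor.\<close>

primrec word_image :: "vbasis list \<Rightarrow> 'g path \<Rightarrow>\<^sub>0 'k" where
  "word_image [] = \<one>\<^bsub>PA\<^esub>"
| "word_image (i # w) = nichols_gen G i \<otimes>\<^bsub>PA\<^esub> word_image w"

lemma one_eq_single: "\<one>\<^bsub>PA\<^esub> = Poly_Mapping.single (word_path []) 1"
  by (simp add: path_algebra_def word_path_def)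

lemma nichols_gen_eq_single: "nichols_gen G i = Poly_Mapping.single (word_path [i]) 1"
  by (simp add: nichols_gen_def word_path_def)

lemma coeff_single: "coeff (Poly_Mapping.single (word_path w) 1) = word_delta w"
  by (auto simp: coeff_def word_delta_def lookup_single when_def)

lemma word_supported_word_image: "word_supported (word_image w)"
  by (induction w) (simp_all add: one_eq_single nichols_gen_eq_single word_supported_single word_supported_mult)

lemma one_mult_word_supported: "word_supported x \<Longrightarrow> \<one>\<^bsub>PA\<^esub> \<otimes>\<^bsub>PA\<^esub> x = x"
  by (rule word_supported_eqI)
    (simp_all add: one_eq_single word_supported_mult word_supported_single coeff_mult coeff_single tw_shuffle_one_left)

lemma mult_one_word_supported: "word_supported x \<Longrightarrow> x \<otimes>\<^bsub>PA\<^esub> \<one>\<^bsub>PA\<^esub> = x"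
  by (rule word_supported_eqI)
    (simp_all add: one_eq_single word_supported_mult word_supported_single coeff_mult coeff_single tw_shuffle_one_right)

text \<open>On coefficient functions the product is \<open>tw_shuffle\<close>, which is associative.
  The generators are word-supported, and so are all their products.\<close>

lemma mult_assoc_word_supported:
  assumes "word_supported x" "word_supported y" "word_supported z"
  shows "x \<otimes>\<^bsub>PA\<^esub> (y \<otimes>\<^bsub>PA\<^esub> z) = (x \<otimes>\<^bsub>PA\<^esub> y) \<otimes>\<^bsub>PA\<^esub> z"
proof (rule word_supported_eqI)
  have c: "coeff (a \<otimes>\<^bsub>PA\<^esub> b) = tw_shuffle (coeff a) (coeff b)"
    if "word_supported a" "word_supported b" for a b
    using coeff_mult[OF that] by blast
  show "coeff (x \<otimes>\<^bsub>PA\<^esub> (y \<otimes>\<^bsub>PA\<^esub> z)) w = coeff (x \<otimes>\<^bsub>PA\<^esub> y \<otimes>\<^bsub>PA\<^esub> z) w" for w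
    using assms by (simp add: c word_supported_mult tw_shuffle_assoc)
qed (use assms word_supported_mult in blast)+

lemma word_image_append: "word_image (u @ v) = word_image u \<otimes>\<^bsub>PA\<^esub> word_image v"
proof (induction u)
  case Nil
  then show ?case by (simp add: one_mult_word_supported word_supported_word_image)
next
  case (Cons i u)
  have "word_supported (nichols_gen G i)"
    by (simp add: nichols_gen_eq_single word_supported_single)
  then show ?case
    using Cons by (simp add: mult_assoc_word_supported word_supported_word_image)
qed

section \<open>The homomorphism and its image\<close>

definition tensor_map :: "(word \<Rightarrow>\<^sub>0 'k) \<Rightarrow> ('g path \<Rightarrow>\<^sub>0 'k)" where
  "tensor_map = lin_ext (\<lambda>p. case p of Word w \<Rightarrow> word_image w)"

lemma linear_tensor_map: "Vector_Spaces.linear scale scale tensor_map"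
  unfolding tensor_map_def by (rule linear_lin_ext)

lemma tensor_map_single: "tensor_map (Poly_Mapping.single (Word w) 1) = word_image w"
  by (simp add: tensor_map_def)

lemma word_supported_tensor_map: "word_supported (tensor_map x)"
  unfolding tensor_map_def
  by (rule word_supported_lin_ext) (simp add: word_supported_word_image split: word.split)

text \<open>Both sides are linear in each argument, which leaves pairs of words, where concatenation
  goes to the product.\<close>

lemma tensor_map_mult: "tensor_map (x * y) = tensor_map x \<otimes>\<^bsub>PA\<^esub> tensor_map y"
proof (rule linear_eq_on_basis[of "\<lambda>x. tensor_map (x * y)"])
  show "Vector_Spaces.linear scale scale (\<lambda>x. tensor_map (x * y))"
    by (rule linear_compose[OF linear_mult_left linear_tensor_map])
  show "Vector_Spaces.linear scale scale (\<lambda>x. tensor_map x \<otimes>\<^bsub>PA\<^esub> tensor_map y)"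
    by (rule linear_compose[OF linear_tensor_map linear_path_algebra_mult_left])
  fix p
  show "tensor_map (Poly_Mapping.single p 1 * y) = tensor_map (Poly_Mapping.single p 1) \<otimes>\<^bsub>PA\<^esub> tensor_map y"
  proof (rule linear_eq_on_basis[of "\<lambda>y. tensor_map (Poly_Mapping.single p 1 * y)"])
    show "Vector_Spaces.linear scale scale (\<lambda>y. tensor_map (Poly_Mapping.single p 1 * y))"
      by (rule linear_compose[OF linear_mult_right linear_tensor_map])
    show "Vector_Spaces.linear scale scale (\<lambda>y. tensor_map (Poly_Mapping.single p 1) \<otimes>\<^bsub>PA\<^esub> tensor_map y)"
      by (rule linear_compose[OF linear_tensor_map linear_path_algebra_mult_right])
    fix q
    show "tensor_map (Poly_Mapping.single p 1 * Poly_Mapping.single q 1) =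
        tensor_map (Poly_Mapping.single p 1) \<otimes>\<^bsub>PA\<^esub> tensor_map (Poly_Mapping.single q 1)"
      by (cases p; cases q) (simp add: mult_single tensor_map_single word_image_append)
  qed
qed

lemma tensor_map_one: "tensor_map 1 = \<one>\<^bsub>PA\<^esub>"
  using tensor_map_single[of "[]"] by (simp flip: zero_word_def)

lemma tensor_map_gen: "tensor_map (tensor_gen i) = nichols_gen G i"
  unfolding tensor_gen_def tensor_map_single
  by (simp add: nichols_gen_eq_single mult_one_word_supported[unfolded one_eq_single] one_eq_single word_supported_single)

text \<open>The range is a subalgebra that contains \<open>V\<close>, so it contains the generated
  one. Conversely a subalgebra that contains \<open>V\<close> contains every
  \<open>word_image\<close>, by recursion on the word, hence all their combinations.\<close>

lemma nichols_carrier_eq_range: "carrier (nichols_algebra G g act) = range tensor_map"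
proof -
  interpret t: Vector_Spaces.linear scale scale tensor_map
    by (rule linear_tensor_map)
  let ?X = "vs.span {nichols_gen G V1, nichols_gen G V2} :: ('g path \<Rightarrow>\<^sub>0 'k) set"
  have sub: "vs.subspace (range tensor_map)"
    using t.subspace_image[OF vs.subspace_UNIV] .
  have "is_subalgebra (range tensor_map) PA"
    unfolding is_subalgebra_def
  proof (intro conjI ballI)
    show "range tensor_map \<subseteq> carrier PA"
      using word_supported_carrier word_supported_tensor_map by auto
    show "\<one>\<^bsub>PA\<^esub> \<in> range tensor_map"
      using tensor_map_one by (metis rangeI)
    show "x \<otimes>\<^bsub>PA\<^esub> y \<in> range tensor_map" if "x \<in> range tensor_map" "y \<in> range tensor_map" for x y
      using that by (auto simp flip: tensor_map_mult)
  qed (rule sub)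
  moreover have "?X \<subseteq> range tensor_map"
    by (rule vs.span_minimal[OF _ sub]) (auto simp flip: tensor_map_gen)
  moreover have "range tensor_map \<subseteq> S" if S: "is_subalgebra S PA" "?X \<subseteq> S" for S
  proof -
    have "nichols_gen G i \<in> S" for i
      using S(2) by (cases i) (auto intro: vs.span_base)
    then have "word_image w \<in> S" for w
      using S(1) by (induction w) (auto simp: is_subalgebra_def)
    then show ?thesis
      using S(1) unfolding is_subalgebra_def tensor_map_def lin_ext_def
      by (auto intro!: vs.subspace_sum vs.subspace_scale split: word.split)
  qed
  ultimately show ?thesis
    unfolding nichols_algebra_def generated_subalgebra_def by auto
qed

lemma tensor_map_ring_hom: "tensor_map \<in> ring_hom tensor_algebra PA"
proof -
  interpret t: Vector_Spaces.linear scale scale tensor_map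
    by (rule linear_tensor_map)
  have "Poly_Mapping.keys (tensor_map x) \<subseteq> paths G g" for x
    using word_supported_carrier[OF word_supported_tensor_map] by (simp add: path_algebra_def)
  then show ?thesis
    using tensor_map_mult tensor_map_one t.add
    by (intro ring_hom_memI) (simp_all add: tensor_algebra_def path_algebra_def)
qed

end

section \<open>Relations and monomials\<close>

definition monom_word :: "vbasis list \<Rightarrow> (word \<Rightarrow>\<^sub>0 'k::field)" where
  "monom_word w = Poly_Mapping.single (Word w) 1"

lemma monom_word_mult: "monom_word u * monom_word v = monom_word (u @ v)"
  by (simp add: monom_word_def mult_single)

lemma monom_word_Nil: "1 = monom_word []"
  by (simp add: monom_word_def flip: zero_word_def)

lemma tensor_gen_eq_monom_word: "tensor_gen i = monom_word [i]"
  by (simp add: monom_word_def tensor_gen_def)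

lemmas monomial_simps = tensor_gen_eq_monom_word monom_word_mult power2_eq_square power3_eq_cube
  power4_eq_xxxx monom_word_Nil

definition nichols_words :: "vbasis list list" where
  "nichols_words = [[], [V1], [V2], [V1,V2], [V2,V1], [V2,V2], [V1,V2,V1], [V1,V2,V2], [V2,V1,V2],
     [V2,V2,V2], [V1,V2,V1,V2], [V1,V2,V2,V2], [V2,V1,V2,V2], [V1,V2,V1,V2,V2], [V2,V1,V2,V2,V2],
     [V1,V2,V1,V2,V2,V2]]"

lemma tensor_algebra_ring: "ring (tensor_algebra :: (word \<Rightarrow>\<^sub>0 'k::field) ring)"
proof (rule ringI)
  show "abelian_group (tensor_algebra :: (word \<Rightarrow>\<^sub>0 'k) ring)"
  proof (rule abelian_groupI)
    fix x :: "word \<Rightarrow>\<^sub>0 'k"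
    show "\<exists>y\<in>carrier tensor_algebra. y \<oplus>\<^bsub>tensor_algebra\<^esub> x = \<zero>\<^bsub>tensor_algebra\<^esub>"
      by (rule bexI[of _ "- x"]) (simp_all add: tensor_algebra_def)
  qed (simp_all add: tensor_algebra_def add_ac)
  show "Group.monoid (tensor_algebra :: (word \<Rightarrow>\<^sub>0 'k) ring)"
    by (rule monoidI) (simp_all add: tensor_algebra_def mult.assoc)
qed (simp_all add: tensor_algebra_def distrib_left distrib_right)

text \<open>The span of the sixteen monomials is closed, modulo an ideal containing the relations, under left
  multiplication by the generators.\<close>

lemma span_nichols_words_mod:
  fixes J :: "(word \<Rightarrow>\<^sub>0 'k::field) set" and x :: "word \<Rightarrow>\<^sub>0 'k"
  assumes char2: "\<And>y :: word \<Rightarrow>\<^sub>0 'k. y + y = 0"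
    and add: "\<And>x y. x \<in> J \<Longrightarrow> y \<in> J \<Longrightarrow> x + y \<in> J"
    and left: "\<And>r x. x \<in> J \<Longrightarrow> r * x \<in> J"
    and right: "\<And>r x. x \<in> J \<Longrightarrow> x * r \<in> J"
    and aa: "monom_word [V1, V1] \<in> J"
    and bbbb: "monom_word [V2, V2, V2, V2] \<in> J"
    and bba: "monom_word [V2, V2, V1] + monom_word [V1, V2, V2] + monom_word [V1, V2, V1] \<in> J"
    and abab: "monom_word [V1, V2, V1, V2] + monom_word [V2, V1, V2, V1] \<in> J"
  shows "\<exists>s \<in> vs.span (monom_word ` set nichols_words). x - s \<in> J"
proof -
  let ?B = "monom_word ` set nichols_words :: (word \<Rightarrow>\<^sub>0 'k) set"
  define R where "R x \<longleftrightarrow> (\<exists>s \<in> vs.span ?B. x - s \<in> J)" for x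
  have zero: "0 \<in> J"
    using left[OF aa, of 0] by simp
  have R_J: "R x" if "x \<in> J" for x
    using that vs.span_zero[of ?B] unfolding R_def by force
  have R_add: "R (x + y)" if R: "R x" "R y" for x y
  proof -
    obtain s t where "s \<in> vs.span ?B" "t \<in> vs.span ?B" "x - s \<in> J" "y - t \<in> J"
      using R unfolding R_def by blast
    then have "s + t \<in> vs.span ?B" "(x + y) - (s + t) \<in> J"
      using add[of "x - s" "y - t"] by (auto simp: vs.span_add algebra_simps)
    then show ?thesis
      unfolding R_def by blast
  qed
  have R_scale: "R (scale c x)" if R: "R x" for c x
  proof -
    obtain s where s: "s \<in> vs.span ?B" "x - s \<in> J"
      using R unfolding R_def by blast
    have "scale c x - scale c s = Poly_Mapping.single 0 c * (x - s)"
      by (simp add: scale_def mult_map_scale_conv_mult right_diff_distrib)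
    then show ?thesis
      unfolding R_def using left[OF s(2)] vs.span_scale[OF s(1)] by metis
  qed
  have R_base: "R (monom_word w)" if "w \<in> set nichols_words" for w
    unfolding R_def using that zero by (intro bexI[of _ "monom_word w"]) (auto intro: vs.span_base)
  \<comment> \<open>In characteristic two \<open>x = (x + y) + y\<close>, so a relation can be used
    to replace one side by the other.\<close>
  have R_cong: "R x" if J: "x + y \<in> J" and y: "R y" for x y
  proof -
    have "R (x + y + y)"
      by (rule R_add[OF R_J[OF J] y])
    then show ?thesis
      by (simp add: add.assoc char2)
  qed
  have R_aa: "R (monom_word (V1 # V1 # w))" for w
    using R_J[OF right[OF aa, of "monom_word w"]] by (simp add: monom_word_mult)
  have R_bbbb: "R (monom_word (u @ V2 # V2 # V2 # V2 # w))" for u w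
    using R_J[OF right[OF left[OF bbbb, of "monom_word u"], of "monom_word w"]] by (simp add: monom_word_mult)
  \<comment> \<open>The relations are oriented as rewrite rules: \<open>bba\<close> goes to
    \<open>abb + aba\<close>, and below \<open>baba\<close> goes to \<open>abab\<close>.\<close>
  have R_bba: "R (monom_word (V2 # V2 # V1 # w))"
    if "R (monom_word (V1 # V2 # V2 # w))" "R (monom_word (V1 # V2 # V1 # w))" for w
    using right[OF bba, of "monom_word w"] R_cong R_add[OF that]
    by (simp add: monom_word_mult distrib_right add.assoc)
  have R_baba: "R (monom_word (V2 # V1 # V2 # V1 # w))" if "R (monom_word (V1 # V2 # V1 # V2 # w))" for w
    using right[OF abab, of "monom_word w"] R_cong[OF _ that]
    by (simp add: monom_word_mult distrib_right add.commute)
  note bs = R_base[unfolded nichols_words_def, simplified]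
  \<comment> \<open>These are the prefixes that rewriting leaves in front of \<open>bbbb\<close>;
    for instance \<open>bababbb\<close> turns into \<open>ababbbb\<close>.\<close>
  note bbbb' = R_bbbb[of "[]", simplified] R_bbbb[of "[V1]", simplified] R_bbbb[of "[V1,V2,V1]", simplified]
  have "\<forall>w\<in>set nichols_words. R (monom_word (V1 # w)) \<and> R (monom_word (V2 # w))"
    unfolding nichols_words_def by (simp add: bs bbbb' R_aa R_bba R_baba)
  then have R_Cons: "R (monom_word (i # w))" if "w \<in> set nichols_words" for i w
    using that by (cases i) simp_all
  \<comment> \<open>The error \<open>x - s\<close> stays in \<open>J\<close> under left
    multiplication, and on the span the closure just shown applies.\<close>
  have R_mult: "R (monom_word [i] * x)" if Rx: "R x" for i x
  proof -
    have "R (monom_word [i] * s)" if "s \<in> vs.span ?B" for s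
      using that
    proof (induction rule: vs.span_induct_alt)
      case base
      then show ?case by (simp add: R_J zero)
    next
      case (step c x y)
      then show ?case
        by (auto simp: distrib_left scale_mult_right monom_word_mult intro!: R_add R_scale R_Cons)
    qed
    moreover obtain s where s: "s \<in> vs.span ?B" "x - s \<in> J"
      using Rx unfolding R_def by blast
    moreover have "monom_word [i] * x = monom_word [i] * (x - s) + monom_word [i] * s"
      by (simp add: algebra_simps)
    ultimately show ?thesis
      using R_add[OF R_J[OF left[OF s(2)]]] by simp
  qed
  have R_word: "R (monom_word w)" for w
  proof (induction w)
    case Nil
    then show ?case by (simp add: bs)
  next
    case (Cons i w)
    then show ?case
      using R_mult[of "monom_word w" i] by (simp add: monom_word_mult)
  qed
  have "R (\<Sum>p\<in>A. scale (Poly_Mapping.lookup x p) (Poly_Mapping.single p 1))" for A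
  proof (induction A rule: infinite_finite_induct)
    case (insert p A)
    have "R (Poly_Mapping.single p 1)"
      using R_word by (cases p) (simp add: monom_word_def)
    with insert show ?case
      by (simp add: R_add R_scale)
  qed (simp_all add: R_J zero)
  then have "R x"
    using lin_ext_basis[of x] unfolding lin_ext_def by metis
  then show ?thesis
    unfolding R_def .
qed

text \<open>In characteristic two, \<open>insert_letter i F [] z\<close> is the coefficient of \<open>z\<close> in the product of the
  letter \<open>i\<close> with the combination of words \<open>F\<close>; the third argument is the part of \<open>z\<close> already
  read.\<close>

fun insert_letter :: "vbasis \<Rightarrow> (vbasis list \<Rightarrow> bool) \<Rightarrow> vbasis list \<Rightarrow> vbasis list \<Rightarrow> bool" where
  "insert_letter i F p [] = False"
| "insert_letter i F p (c # z) =
     (insert_letter i F (p @ [c]) z \<noteq>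
       (if i = c then F (p @ z) else if c = V1 \<and> odd (length z) then F (p @ z) else False))"

text \<open>Boolean counterpart of the coefficients of \<open>word_image w\<close>, in a form that
  evaluation can compute. The first argument is a monomial in its usual order, the second a word
  read backwards.\<close>

primrec word_coeff :: "vbasis list \<Rightarrow> vbasis list \<Rightarrow> bool" where
  "word_coeff [] z = (z = [])"
| "word_coeff (i # w) z = insert_letter i (word_coeff w) [] z"

section \<open>Homogeneity and finite evaluation of coefficients\<close>

lemma insert_letter_length:
  assumes "\<And>w. F w \<Longrightarrow> length w = n" "insert_letter i F p z"
  shows "length p + length z = Suc n"
  using assms(2)
proof (induction z arbitrary: p)
  case (Cons c z)
  then show ?case
    using assms(1)[of "p @ z"] Cons.IH[of "p @ [c]"] by (auto split: if_splits)
qed simp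

lemma word_coeff_length: "word_coeff w z \<Longrightarrow> length z = length w"
proof (induction w arbitrary: z)
  case (Cons i w)
  then show ?case
    using insert_letter_length[of "word_coeff w" "length w" i "[]" z] by simp
qed simp

text \<open>Together with homogeneity this turns a claim about all words into a finite check that
  \<open>code_simp\<close> can decide.\<close>

lemma all_words_length:
  assumes "\<forall>z\<in>set (List.n_lists n [V1, V2]). P z" "length z = n"
  shows "P z"
proof -
  have "z \<in> set (List.n_lists n [V1, V2])"
    using assms(2) vbasis.exhaust by (auto simp: set_n_lists)
  then show ?thesis
    using assms(1) by blast
qed

lemma word_coeff_aa: "\<not> word_coeff [V1, V1] z"
proof (cases "length z = 2")
  case True
  have "\<forall>z\<in>set (List.n_lists 2 [V1, V2]). \<not> word_coeff [V1, V1] z"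
    by code_simp
  then show ?thesis
    using True by (rule all_words_length)
qed (use word_coeff_length in fastforce)

lemma word_coeff_bbbb: "\<not> word_coeff [V2, V2, V2, V2] z"
proof (cases "length z = 4")
  case True
  have "\<forall>z\<in>set (List.n_lists 4 [V1, V2]). \<not> word_coeff [V2, V2, V2, V2] z"
    by code_simp
  then show ?thesis
    using True by (rule all_words_length)
qed (use word_coeff_length in fastforce)

text \<open>Inequality of truth values is addition modulo two, so this is the relation
  \<open>bba + abb + aba = 0\<close> read on coefficients.\<close>

lemma word_coeff_bba:
  "word_coeff [V2, V2, V1] z = (word_coeff [V1, V2, V2] z \<noteq> word_coeff [V1, V2, V1] z)"
proof (cases "length z = 3")
  case True
  have "\<forall>z\<in>set (List.n_lists 3 [V1, V2]).
      word_coeff [V2, V2, V1] z = (word_coeff [V1, V2, V2] z \<noteq> word_coeff [V1, V2, V1] z)"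
    by code_simp
  then show ?thesis
    using True by (rule all_words_length)
qed (use word_coeff_length in fastforce)

lemma word_coeff_abab: "word_coeff [V1, V2, V1, V2] z = word_coeff [V2, V1, V2, V1] z"
proof (cases "length z = 4")
  case True
  have "\<forall>z\<in>set (List.n_lists 4 [V1, V2]). word_coeff [V1, V2, V1, V2] z = word_coeff [V2, V1, V2, V1] z"
    by code_simp
  then show ?thesis
    using True by (rule all_words_length)
qed (use word_coeff_length in fastforce)

text \<open>A triangular system: row \<open>i\<close> has a nonzero coefficient at the test word \<open>i\<close>, where all later
  rows vanish.\<close>

definition triangular_rows :: "(vbasis list \<times> vbasis list) list" where
  "triangular_rows =
    [([], []), ([V1], [V1]), ([V2], [V2]), ([V2,V1], [V1,V1]), ([V1,V2], [V2,V1]), ([V2,V2], [V1,V2]),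
     ([V1,V2,V1], [V1,V1,V1]), ([V1,V2,V2], [V1,V2,V1]), ([V2,V1,V2], [V2,V1,V1]),
     ([V2,V2,V2], [V2,V1,V2]), ([V1,V2,V1,V2], [V2,V1,V1,V1]), ([V1,V2,V2,V2], [V1,V1,V1,V2]),
     ([V2,V1,V2,V2], [V1,V2,V1,V1]), ([V2,V1,V2,V2,V2], [V1,V1,V2,V1,V1]),
     ([V1,V2,V1,V2,V2], [V1,V1,V1,V2,V1]), ([V1,V2,V1,V2,V2,V2], [V1,V1,V1,V2,V1,V1])]"

text \<open>The rows list the monomials in an order adapted to triangularity, which differs from
  that of \<open>nichols_words\<close>; hence the comparison as sets.\<close>

lemma set_triangular_rows: "set (map fst triangular_rows) = set nichols_words"
  unfolding triangular_rows_def nichols_words_def by auto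

lemma triangular_rows_coeff:
  "sorted_wrt (\<lambda>r r'. \<not> word_coeff (fst r') (snd r)) triangular_rows"
  "\<forall>r\<in>set triangular_rows. word_coeff (fst r) (snd r)"
  by code_simp+

text \<open>Once the letter \<open>i\<close> is placed, the empty word remains on the left, and that
  is the unit. Until then the letters passed over collect in the prefix \<open>p\<close>, so that
  the right factor stays a shift of the fixed \<open>F\<close>.\<close>

lemma (in nichols_setup) tw_shuffle_insert_letter:
  assumes "(2 :: 'k) = 0"
  shows "tw_shuffle (word_delta [i]) (\<lambda>w. of_bool (F (p @ w))) z = (of_bool (insert_letter i F p z) :: 'k)"
proof (induction z arbitrary: p)
  case Nil
  then show ?case by (simp add: word_delta_def)
next
  case (Cons c z)
  \<comment> \<open>In characteristic two exclusive disjunction becomes a sum, and the twist by the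
    length matters only through its parity.\<close>
  have xor: "of_bool (p \<noteq> q) = (of_bool p + of_bool q :: 'k)" for p q
    using assms by (cases p; cases q) auto
  have "(of_nat n :: 'k) = of_bool (odd n)" for n
    using assms by (cases "even n") (auto elim!: evenE oddE)
  then show ?case
    using assms Cons.IH[of "p @ [c]"]
    by (cases i; cases c) (auto simp: xor word_delta_Cons_Cons tw_shuffle_mult_left tw_shuffle_one_left deg_weight_def)
qed

section \<open>The presentation\<close>

text \<open>An isomorphism theorem in which \<open>S\<close> is just the target of a homomorphism,
  because associativity of the path algebra has been established on word-supported elements
  only.\<close>

lemma (in ring) ring_iso_image_Quot:
  assumes h: "h \<in> ring_hom R S" and I: "ideal I R"
    and ker: "\<And>x y. x \<in> carrier R \<Longrightarrow> y \<in> carrier R \<Longrightarrow> h x = h y \<longleftrightarrow> x \<ominus> y \<in> I"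
  obtains \<Phi> where "\<Phi> \<in> ring_iso (R Quot I) (S\<lparr>carrier := h ` carrier R\<rparr>)"
    "\<And>x. x \<in> carrier R \<Longrightarrow> \<Phi> (I +> x) = h x"
proof -
  interpret I: ideal I R by fact
  \<comment> \<open>The value on a coset is taken at a chosen representative; \<open>same\<close>
    shows that the choice is immaterial and also gives injectivity.\<close>
  define \<Phi> where "\<Phi> X = h (SOME x. x \<in> carrier R \<and> I +> x = X)" for X
  have same: "I +> x = I +> y \<longleftrightarrow> h x = h y" if "x \<in> carrier R" "y \<in> carrier R" for x y
    using quotient_eq_iff_same_a_r_cos[OF I that] ker[OF that] by simp
  have \<Phi>: "\<Phi> (I +> x) = h x" if "x \<in> carrier R" for x
  proof -
    have "\<exists>y. y \<in> carrier R \<and> I +> y = I +> x"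
      using that by blast
    then have "(SOME y. y \<in> carrier R \<and> I +> y = I +> x) \<in> carrier R \<and>
        I +> (SOME y. y \<in> carrier R \<and> I +> y = I +> x) = I +> x"
      by (rule someI_ex)
    then show ?thesis
      unfolding \<Phi>_def using same that by blast
  qed
  have carr: "carrier (R Quot I) = (\<lambda>x. I +> x) ` carrier R"
    by (auto simp: FactRing_simps)
  have ops: "X \<otimes>\<^bsub>R Quot I\<^esub> Y = [mod I:] X \<Otimes> Y" "X \<oplus>\<^bsub>R Quot I\<^esub> Y = X <+> Y" for X Y
    by (simp_all add: FactRing_def)
  have "\<Phi> \<in> ring_iso (R Quot I) (S\<lparr>carrier := h ` carrier R\<rparr>)"
  proof (rule ring_iso_memI)
    show "bij_betw \<Phi> (carrier (R Quot I)) (carrier (S\<lparr>carrier := h ` carrier R\<rparr>))"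
      unfolding carr by (auto simp: bij_betw_def inj_on_def \<Phi> same image_image cong: image_cong)
    show "\<Phi> \<one>\<^bsub>R Quot I\<^esub> = \<one>\<^bsub>S\<lparr>carrier := h ` carrier R\<rparr>\<^esub>"
      using \<Phi>[OF one_closed] ring_hom_one[OF h] by (simp add: FactRing_def)
  qed (use h in \<open>auto simp: carr \<Phi> ops I.rcoset_mult_add I.a_rcos_sum ring_hom_mult ring_hom_add\<close>)
  then show ?thesis
    using \<Phi> by (rule that)
qed

section \<open>Relations, independence and the kernel in characteristic two\<close>

context nichols_setup
begin

lemma coeff_word_image:
  assumes "(2 :: 'k) = 0"
  shows "coeff (word_image w) z = of_bool (word_coeff w z)"
proof (induction w arbitrary: z)
  case Nil
  then show ?case by (simp add: one_eq_single coeff_single word_delta_def)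
next
  case (Cons i w)
  \<comment> \<open>The form \<open>[] @ z\<close> matches the initially empty prefix in
    \<open>tw_shuffle_insert_letter\<close>.\<close>
  have "coeff (word_image w) = (\<lambda>z. of_bool (word_coeff w ([] @ z)))"
    using Cons by auto
  then have "coeff (word_image (i # w)) z = tw_shuffle (word_delta [i]) (\<lambda>z. of_bool (word_coeff w ([] @ z))) z"
    by (simp add: coeff_mult nichols_gen_eq_single word_supported_single word_supported_word_image coeff_single)
  then show ?case
    using tw_shuffle_insert_letter[OF assms, of i "word_coeff w" "[]" z] by simp
qed

lemma word_image_eq_0I:
  assumes "(2 :: 'k) = 0" "\<And>z. \<not> word_coeff w z"
  shows "word_image w = 0"
  using assms
  by (intro word_supported_eqI) (simp_all add: word_supported_zero word_supported_word_image coeff_word_image coeff_def[of 0])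

lemma coeff_add: "coeff (x + y) z = coeff x z + coeff y z"
  by (simp add: coeff_def lookup_add)

lemma word_image_bba:
  assumes "(2 :: 'k) = 0"
  shows "word_image [V2, V2, V1] + word_image [V1, V2, V2] + word_image [V1, V2, V1] = 0"
proof (rule word_supported_eqI)
  fix z
  show "coeff (word_image [V2, V2, V1] + word_image [V1, V2, V2] + word_image [V1, V2, V1]) z = coeff 0 z"
    using assms unfolding coeff_add coeff_word_image[OF assms] word_coeff_bba by (simp add: coeff_def)
qed (intro word_supported_zero word_supported_add word_supported_word_image)+

lemma word_image_abab:
  assumes "(2 :: 'k) = 0"
  shows "word_image [V1, V2, V1, V2] + word_image [V2, V1, V2, V1] = 0"
proof (rule word_supported_eqI)
  fix z
  show "coeff (word_image [V1, V2, V1, V2] + word_image [V2, V1, V2, V1]) z = coeff 0 z"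
    using assms unfolding coeff_add coeff_word_image[OF assms] word_coeff_abab by (simp add: coeff_def)
qed (intro word_supported_zero word_supported_add word_supported_word_image)+

lemma independent_word_images:
  assumes "(2 :: 'k) = 0"
  shows "distinct (map word_image nichols_words)" "vs.independent (set (map word_image nichols_words))"
proof -
  let ?xs = "map (word_image \<circ> fst) triangular_rows"
  have "distinct ?xs \<and> vs.independent (set ?xs)"
  proof (rule independent_triangular[of "map (word_path \<circ> snd) triangular_rows"])
    have *: "Poly_Mapping.lookup (word_image w) (word_path z) = of_bool (word_coeff w z)" for w z
      using coeff_word_image[OF assms] by (simp add: coeff_def)
    show "Poly_Mapping.lookup (?xs ! i) (map (word_path \<circ> snd) triangular_rows ! i) \<noteq> 0"
      if "i < length ?xs" for i
      using that triangular_rows_coeff(2) by (simp add: *)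
    show "Poly_Mapping.lookup (?xs ! j) (map (word_path \<circ> snd) triangular_rows ! i) = 0"
      if "i < j" "j < length ?xs" for i j
      using that triangular_rows_coeff(1) by (simp add: * sorted_wrt_iff_nth_less)
  qed simp
  \<comment> \<open>Equal sets and equal lengths transfer distinctness, since a list is distinct
    exactly if its set has as many elements as its length.\<close>
  moreover have set_eq: "set ?xs = set (map word_image nichols_words)"
    using arg_cong[OF set_triangular_rows, of "image word_image"] by (simp add: image_image)
  moreover have "length ?xs = length (map word_image nichols_words)"
    by (simp add: triangular_rows_def nichols_words_def)
  ultimately show "distinct (map word_image nichols_words)" "vs.independent (set (map word_image nichols_words))"
    by (metis card_distinct distinct_card, metis)
qed

text \<open>The relations are killed, so \<open>I\<close> lies in the kernel. Conversely every
  element is, modulo \<open>I\<close>, a combination of the sixteen monomials, and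
  \<open>tensor_map\<close> is injective on those combinations, so the kernel contains nothing else.
  The same reduction computes the range.\<close>

lemma nichols_presentation:
  fixes a b :: "word \<Rightarrow>\<^sub>0 'k"
  assumes two: "(2 :: 'k) = 0" and a: "a = tensor_gen V1" and b: "b = tensor_gen V2"
  defines "I \<equiv> Idl\<^bsub>tensor_algebra\<^esub>
    {a^2, b^4, b^2 * a + a * b^2 + a * b * a, a * b * a * b + b * a * b * a}"
  shows "ideal I tensor_algebra" "tensor_map x = 0 \<longleftrightarrow> x \<in> I"
    "range tensor_map = vs.span (set (map word_image nichols_words))"
proof -
  interpret T: ring "tensor_algebra :: (word \<Rightarrow>\<^sub>0 'k) ring"
    by (rule tensor_algebra_ring)
  interpret t: Vector_Spaces.linear scale scale tensor_map
    by (rule linear_tensor_map)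
  define S where "S = {monom_word [V1, V1], monom_word [V2, V2, V2, V2],
    monom_word [V2, V2, V1] + monom_word [V1, V2, V2] + monom_word [V1, V2, V1],
    monom_word [V1, V2, V1, V2] + monom_word [V2, V1, V2, V1] :: word \<Rightarrow>\<^sub>0 'k}"
  have I: "I = Idl\<^bsub>tensor_algebra\<^esub> S"
    unfolding I_def S_def a b by (simp add: monomial_simps)
  have S_I: "S \<subseteq> I"
    unfolding I by (rule T.genideal_self) (simp add: tensor_algebra_def)
  show id: "ideal I tensor_algebra"
    unfolding I by (rule T.genideal_ideal) (simp add: tensor_algebra_def)
  interpret I: ideal I tensor_algebra
    by (rule id)
  have mult_zero: "0 \<otimes>\<^bsub>PA\<^esub> y = 0" "y \<otimes>\<^bsub>PA\<^esub> 0 = 0" for y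
    by (simp_all add: path_algebra_def)
  \<comment> \<open>Being an ideal, the kernel contains \<open>I\<close> as soon as it contains the
    four relations.\<close>
  have "ideal {x. tensor_map x = 0} tensor_algebra"
  proof (rule idealI[OF tensor_algebra_ring])
    show "subgroup {x. tensor_map x = 0} (add_monoid tensor_algebra)"
    proof (rule group.subgroupI[OF T.a_group])
      show "inv\<^bsub>add_monoid tensor_algebra\<^esub> x \<in> {x. tensor_map x = 0}" if "x \<in> {x. tensor_map x = 0}" for x
      proof -
        have "inv\<^bsub>add_monoid tensor_algebra\<^esub> x = - x"
          by (rule group.inv_equality[OF T.a_group]) (simp_all add: tensor_algebra_def)
        with that show ?thesis
          by (simp add: t.neg)
      qed
    qed (auto simp: tensor_algebra_def t.add t.zero intro: exI[of _ 0])
  qed (simp_all add: tensor_algebra_def tensor_map_mult mult_zero)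
  moreover have "S \<subseteq> {x. tensor_map x = 0}"
    using word_image_eq_0I[OF two word_coeff_aa] word_image_eq_0I[OF two word_coeff_bbbb]
      word_image_bba[OF two] word_image_abab[OF two]
    by (simp only: S_def insert_subset empty_subsetI mem_Collect_eq t.add tensor_map_single monom_word_def simp_thms)
  ultimately have ker: "tensor_map x = 0" if "x \<in> I" for x
    using T.genideal_minimal that unfolding I by blast
  have reduce: "\<exists>s \<in> vs.span (monom_word ` set nichols_words). x - s \<in> I" for x
  proof (rule span_nichols_words_mod)
    show "y + y = 0" for y :: "word \<Rightarrow>\<^sub>0 'k"
    proof (rule poly_mapping_eqI)
      show "Poly_Mapping.lookup (y + y) k = Poly_Mapping.lookup 0 k" for k
        using two by (metis lookup_add lookup_zero mult_2 mult_zero_left)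
    qed
    show "x + y \<in> I" if "x \<in> I" "y \<in> I" for x y
      using I.a_closed[OF that] by (simp add: tensor_algebra_def)
    show "r * x \<in> I" "x * r \<in> I" if "x \<in> I" for r x
      using I.I_l_closed[OF that, of r] I.I_r_closed[OF that, of r] by (simp_all add: tensor_algebra_def)
  qed (use S_I in \<open>auto simp: S_def\<close>)
  have image: "tensor_map ` monom_word ` set nichols_words = set (map word_image nichols_words)"
    by (simp add: image_image monom_word_def tensor_map_single)
  \<comment> \<open>The monomials have distinct and independent images, which forces injectivity on
    their span.\<close>
  have "inj_on tensor_map (vs.span (monom_word ` set nichols_words))"
  proof (rule t.inj_on_span_independent_image)
    show "vs.independent (tensor_map ` monom_word ` set nichols_words)"
      unfolding image by (rule independent_word_images[OF two])
    show "inj_on tensor_map (monom_word ` set nichols_words)"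
      using independent_word_images(1)[OF two]
      by (auto simp: inj_on_def distinct_map monom_word_def tensor_map_single)
  qed
  then have inj: "s = 0" if "s \<in> vs.span (monom_word ` set nichols_words)" "tensor_map s = 0" for s
    using that vs.span_zero t.zero by (metis inj_onD)
  show "tensor_map x = 0 \<longleftrightarrow> x \<in> I"
  proof
    assume x: "tensor_map x = 0"
    obtain s where s: "s \<in> vs.span (monom_word ` set nichols_words)" "x - s \<in> I"
      using reduce by blast
    have "tensor_map s = 0"
      using ker[OF s(2)] x by (simp add: t.diff)
    then show "x \<in> I"
      using inj[OF s(1)] s(2) by simp
  qed (rule ker)
  show "range tensor_map = vs.span (set (map word_image nichols_words))"
  proof -
    have "tensor_map x \<in> tensor_map ` vs.span (monom_word ` set nichols_words)" for x
    proof -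
      obtain s where s: "s \<in> vs.span (monom_word ` set nichols_words)" "x - s \<in> I"
        using reduce by blast
      then have "tensor_map x = tensor_map s"
        using ker[OF s(2)] by (simp add: t.diff)
      then show ?thesis
        using s(1) by blast
    qed
    then show ?thesis
      unfolding image[symmetric] t.span_image by blast
  qed
qed

end

theorem theorem3p1:
  fixes G :: "('g, 'm) monoid_scheme" and g :: 'g and n :: nat
    and act :: "(vbasis \<Rightarrow>\<^sub>0 'k::field) \<Rightarrow> 'g \<Rightarrow> (vbasis \<Rightarrow>\<^sub>0 'k)"
    and a b :: "word \<Rightarrow>\<^sub>0 'k"
  assumes "CHAR('k) = 2"
    and "group G" and "finite (carrier G)" and "order G = n" and "2 dvd n"
    and "g \<in> carrier G" and "carrier G = generate G {g}"
    and "right_module G act"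
    and "act (basis_vec V1) g = basis_vec V1"
    and "act (basis_vec V2) g = basis_vec V1 + basis_vec V2"
    and "a = tensor_gen V1" and "b = tensor_gen V2"
  shows "\<exists>\<phi> :: (word \<Rightarrow>\<^sub>0 'k) \<Rightarrow> ('g path \<Rightarrow>\<^sub>0 'k).
    Vector_Spaces.linear scale scale \<phi> \<and>
    \<phi> \<in> ring_hom tensor_algebra (path_algebra G g act) \<and>
    \<phi> a = nichols_gen G V1 \<and> \<phi> b = nichols_gen G V2 \<and>
    (let I = Idl\<^bsub>tensor_algebra\<^esub>
               {a^2, b^4, b^2 * a + a * b^2 + a * b * a, a * b * a * b + b * a * b * a}
     in \<exists>\<Phi> \<in> ring_iso (tensor_algebra Quot I) (nichols_algebra G g act).
          \<forall>x. \<Phi> (I +>\<^bsub>tensor_algebra\<^esub> x) = \<phi> x) \<and>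
    vs.dim (carrier (nichols_algebra G g act)) = 16 \<and>
    (let basis = map \<phi>
           [1, a, b, a * b, b * a, b^2, a * b * a, a * b^2, b * a * b, b^3,
            a * b * a * b, a * b^3, b * a * b^2, a * b * a * b^2, b * a * b^3, a * b * a * b^3]
     in distinct basis \<and> vs.independent (set basis) \<and>
        vs.span (set basis) = carrier (nichols_algebra G g act))"
proof -
  interpret N: nichols_setup G g act
    using assms by (simp add: nichols_setup_def nichols_setup_axioms_def)
  interpret T: ring "tensor_algebra :: (word \<Rightarrow>\<^sub>0 'k) ring"
    by (rule tensor_algebra_ring)
  interpret t: Vector_Spaces.linear scale scale N.tensor_map
    by (rule N.linear_tensor_map)
  have two: "(2 :: 'k) = 0"
    using of_nat_CHAR[where 'a = 'k] assms(1) by simp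
  define I where "I = Idl\<^bsub>tensor_algebra\<^esub>
    {a^2, b^4, b^2 * a + a * b^2 + a * b * a, a * b * a * b + b * a * b * a}"
  note pres = N.nichols_presentation[OF two assms(11,12), folded I_def]
  \<comment> \<open>This is the shape of the codomain in \<open>ring_iso_image_Quot\<close>: the
    path algebra with its carrier replaced by the image.\<close>
  have nichols: "nichols_algebra G g act =
      (path_algebra G g act)\<lparr>carrier := N.tensor_map ` carrier tensor_algebra\<rparr>"
    using N.nichols_carrier_eq_range by (simp add: nichols_algebra_def tensor_algebra_def)
  \<comment> \<open>The kernel was described with the subtraction of the type, whereas cosets use
    that of the ring structure.\<close>
  have minus: "x \<ominus>\<^bsub>tensor_algebra\<^esub> y = x - y" for x y :: "word \<Rightarrow>\<^sub>0 'k"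
  proof -
    have "\<ominus>\<^bsub>tensor_algebra\<^esub> y = - y"
      by (rule T.minus_equality) (simp_all add: tensor_algebra_def)
    then show ?thesis
      by (simp add: a_minus_def) (simp add: tensor_algebra_def)
  qed
  have ker: "N.tensor_map x = N.tensor_map y \<longleftrightarrow> x \<ominus>\<^bsub>tensor_algebra\<^esub> y \<in> I" for x y
    unfolding minus pres(2)[symmetric] by (simp add: t.diff)
  obtain \<Phi> where iso: "\<Phi> \<in> ring_iso (tensor_algebra Quot I) (nichols_algebra G g act)"
      "\<And>x. \<Phi> (I +>\<^bsub>tensor_algebra\<^esub> x) = N.tensor_map x"
    using T.ring_iso_image_Quot[OF N.tensor_map_ring_hom pres(1) ker] unfolding nichols
    by (auto simp: tensor_algebra_def)
  have basis: "map N.tensor_map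
      [1, a, b, a * b, b * a, b^2, a * b * a, a * b^2, b * a * b, b^3,
        a * b * a * b, a * b^3, b * a * b^2, a * b * a * b^2, b * a * b^3, a * b * a * b^3] =
      map N.word_image nichols_words"
    unfolding assms(11,12) monomial_simps nichols_words_def
    by (simp only: monomial_simps list.map append.simps) (simp only: monom_word_def N.tensor_map_single)
  have carr: "carrier (nichols_algebra G g act) = vs.span (set (map N.word_image nichols_words))"
    using N.nichols_carrier_eq_range pres(3) by simp
  have dim: "vs.dim (carrier (nichols_algebra G g act)) = 16"
    unfolding carr vs.dim_span_eq_card_independent[OF N.independent_word_images(2)[OF two]]
      distinct_card[OF N.independent_word_images(1)[OF two]]
    by (simp add: nichols_words_def)
  have gens: "N.tensor_map a = nichols_gen G V1" "N.tensor_map b = nichols_gen G V2"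
    unfolding assms(11,12) by (rule N.tensor_map_gen)+
  show ?thesis
    unfolding Let_def I_def[symmetric]
    using iso gens N.independent_word_images[OF two]
    by (intro exI[of _ N.tensor_map] conjI bexI[of _ \<Phi>] allI N.linear_tensor_map N.tensor_map_ring_hom dim)
      (simp_all only: basis carr not_False_eq_True)
qed

end
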